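(* For every natural number $n>1$ and every $\aleph_0$-branching, strongly homogeneous Souslin tree $T$ there are free Souslin trees $S_0,\ldots,S_{n-1}$ such that $T\cong\bigotimes_{m<n}S_m$.
   Context: A tree is a partial order $(T,<_T)$ in which the set of predecessors of every node $t$ is well-ordered by $<_T$; its order type is the height $\mathrm{ht}(t)$ of $t$. $T_\alpha$ is the set of nodes of height $\alpha$, and the height of $T$ is the least $\alpha$ with $T_\alpha=\emptyset$. For $t\in T$, $T(t)=\{s\in T: t\le_T s\}$ with the inherited order. $T$ is $\aleph_0$-splitting ($=\aleph_0$-branching) if every node that is not a leaf has exactly $\aleph_0$ immediate successors. $T$ is normal if: (a) there is a single minimal node (the root); (b) each node $s$ with $\mathrm{ht}(s)+1<\mathrm{ht}\,T$ has at least two immediate successors; (c) each node has successors in every higher non-empty level; (d) nodes of the same limit height with the same set of predecessors are equal. An antichain is a set of pairwise incomparable nodes; $T$ satisfies the c.c.c. if all its antichains are countable. A branch is a linearly ordered, downward closed subset. A Souslin tree is a tree of height $\omega_1$ all of whose antichains and all of whose branches are countable. Convention: all Souslin trees are assumed normal and $\aleph_0$-splitting. For trees $T^i$ ($i\in I$) of the same height $\mu$, the tree product is $\bigotimes_{i\in I}T^i=\bigcup_{\alpha<\mu}\prod_{i\in I}T^i_\alpha$ with the coordinatewise tree order. $\cong$ denotes isomorphism of partial orders. A Souslin tree $T$ is strongly homogeneous if there is a family $(\psi_{st}\mid s,t\in T,\ \mathrm{ht}(s)=\mathrm{ht}(t))$ (a coherent family) such that: (1) $\psi_{st}:T(s)\to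 T(t)$ is a tree isomorphism and $\psi_{ss}$ is the identity; (2) $\psi_{rt}=\psi_{st}\circ\psi_{rs}$ for all $r,s,t$ of the same level; (3) if $r,s$ are on the same level, $t$ is above $r$ and $u=\psi_{rs}(t)$, then $\psi_{tu}$ is the restriction of $\psi_{rs}$ to $T(t)$; (4) if $t,u$ are on the same limit level $T_\alpha$, then there is $\gamma<\alpha$ such that for the predecessors $r$ of $t$ and $s$ of $u$ on level $T_\gamma$ we have $\psi_{rs}(t)=u$. A normal tree $T$ of height $\omega_1$ is free if for every finite non-empty set of (pairwise distinct) nodes $s_0,\ldots,s_k$ of $T$ of the same height, the tree product $\bigotimes_{i=0}^kT(s_i)$ satisfies the c.c.c. *)

theory Defs
  imports "HOL-Library.Countable_Set" "HOL-Library.FuncSet"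
begin

unbundle cardinal_syntax

(* A tree is given by its reflexive order \<le>_T as a relation T; its set of nodes is Field T.
   Ordinals are represented by well-order relations up to =o, compared by <o; thus no choice of a
   type of ordinals is needed. *)

definition tree :: "'a rel \<Rightarrow> bool" where
  "tree T \<longleftrightarrow> Partial_order T \<and>
     (\<forall>t\<in>Field T. well_order_on (underS T t) (Restr T (underS T t)))"

definition ht :: "'a rel \<Rightarrow> 'a \<Rightarrow> 'a rel" where
  "ht T t = Restr T (underS T t)"

(* The type of the well-order \<alpha> is arbitrary: it need not be the node type. *)
definition level :: "'a rel \<Rightarrow> 'b rel \<Rightarrow> 'a set" where
  "level T \<alpha> = {t \<in> Field T. ht T t =o \<alpha>}"

(* \<mu> is the least ordinal with empty level. Every ordinal below \<mu> is represented by a proper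
   initial segment of \<mu>, hence it suffices that \<alpha> ranges over relations on the type of \<mu>. *)
definition has_height :: "'a rel \<Rightarrow> 'b rel \<Rightarrow> bool" where
  "has_height T \<mu> \<longleftrightarrow> Well_order \<mu> \<and> level T \<mu> = {} \<and>
     (\<forall>\<alpha> :: 'b rel. \<alpha> <o \<mu> \<longrightarrow> level T \<alpha> \<noteq> {})"

abbreviation omega1 :: "nat set rel" where
  "omega1 \<equiv> cardSuc natLeq"

definition limit_ordinal :: "'a rel \<Rightarrow> bool" where
  "limit_ordinal \<alpha> \<longleftrightarrow> Well_order \<alpha> \<and> Field \<alpha> \<noteq> {} \<and>
     (\<forall>a\<in>Field \<alpha>. \<exists>b\<in>Field \<alpha>. a \<noteq> b \<and> (a, b) \<in> \<alpha>)"

definition subtree :: "'a rel \<Rightarrow> 'a \<Rightarrow> 'a rel" where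
  "subtree T t = Restr T (above T t)"

definition immediate_successors :: "'a rel \<Rightarrow> 'a \<Rightarrow> 'a set" where
  "immediate_successors T s =
     {t \<in> aboveS T s. \<not> (\<exists>u. u \<in> aboveS T s \<and> t \<in> aboveS T u)}"

definition aleph0_splitting :: "'a rel \<Rightarrow> bool" where
  "aleph0_splitting T \<longleftrightarrow>
     (\<forall>s\<in>Field T. aboveS T s \<noteq> {} \<longrightarrow> |immediate_successors T s| =o natLeq)"

(* In the second clause, {r. r \<le>_T s} has order type ht(s)+1.
   In the third clause, every non-empty level is that of the height of one of its nodes, so
   quantifying over relations \<alpha> on the node type covers all non-empty levels. *)
definition normal_tree :: "'b rel \<Rightarrow> 'a rel \<Rightarrow> bool" where
  "normal_tree \<mu> T \<longleftrightarrow> tree T \<and> has_height T \<mu> \<and>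
     (\<exists>!r. r \<in> Field T \<and> underS T r = {}) \<and>
     (\<forall>s\<in>Field T. Restr T (under T s) <o \<mu> \<longrightarrow>
        (\<exists>t\<in>immediate_successors T s. \<exists>u\<in>immediate_successors T s. t \<noteq> u)) \<and>
     (\<forall>s\<in>Field T. \<forall>\<alpha> :: 'a rel. ht T s <o \<alpha> \<and> level T \<alpha> \<noteq> {} \<longrightarrow>
        (\<exists>t\<in>level T \<alpha>. (s, t) \<in> T)) \<and>
     (\<forall>s\<in>Field T. \<forall>t\<in>Field T. ht T s =o ht T t \<and> limit_ordinal (ht T s) \<and>
        underS T s = underS T t \<longrightarrow> s = t)"

definition antichain :: "'a rel \<Rightarrow> 'a set \<Rightarrow> bool" where
  "antichain T A \<longleftrightarrow> A \<subseteq> Field T \<and>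
     (\<forall>s\<in>A. \<forall>t\<in>A. s \<noteq> t \<longrightarrow> (s, t) \<notin> T \<and> (t, s) \<notin> T)"

definition ccc :: "'a rel \<Rightarrow> bool" where
  "ccc T \<longleftrightarrow> (\<forall>A. antichain T A \<longrightarrow> countable A)"

definition branch :: "'a rel \<Rightarrow> 'a set \<Rightarrow> bool" where
  "branch T B \<longleftrightarrow> B \<in> Chains T \<and> (\<forall>t\<in>B. under T t \<subseteq> B)"

(* Souslin trees are by convention normal and aleph_0-splitting. *)
definition Souslin_tree :: "'a rel \<Rightarrow> bool" where
  "Souslin_tree T \<longleftrightarrow> normal_tree omega1 T \<and> aleph0_splitting T \<and> ccc T \<and>
     (\<forall>B. branch T B \<longrightarrow> countable B)"

(* Intended for trees of a common height \<mu>. For non-empty I the explicit bound \<alpha> < \<mu> is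
   superfluous, since a level that is non-empty in some factor lies below \<mu>, and each such \<alpha> is
   represented on the node type. Nodes are extensional functions on I. *)
definition tree_product :: "'i set \<Rightarrow> ('i \<Rightarrow> 'a rel) \<Rightarrow> ('i \<Rightarrow> 'a) rel" where
  "tree_product I T =
     (let N = (\<Union>\<alpha> :: 'a rel. \<Pi>\<^sub>E i\<in>I. level (T i) \<alpha>)
      in {(f, g) \<in> N \<times> N. \<forall>i\<in>I. (f i, g i) \<in> T i})"

definition tree_iso :: "('a \<Rightarrow> 'b) \<Rightarrow> 'a rel \<Rightarrow> 'b rel \<Rightarrow> bool" where
  "tree_iso f T U \<longleftrightarrow> bij_betw f (Field T) (Field U) \<and>
     (\<forall>s\<in>Field T. \<forall>t\<in>Field T. (s, t) \<in> T \<longleftrightarrow> (f s, f t) \<in> U)"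

definition tree_isomorphic :: "'a rel \<Rightarrow> 'b rel \<Rightarrow> bool" where
  "tree_isomorphic T U \<longleftrightarrow> (\<exists>f. tree_iso f T U)"

abbreviation same_level :: "'a rel \<Rightarrow> 'a \<Rightarrow> 'a \<Rightarrow> bool" where
  "same_level T s t \<equiv> s \<in> Field T \<and> t \<in> Field T \<and> ht T s =o ht T t"

(* The values of \<psi> s t are relevant only for s, t on the same level and only on the nodes above s. *)
definition coherent_family :: "'a rel \<Rightarrow> ('a \<Rightarrow> 'a \<Rightarrow> 'a \<Rightarrow> 'a) \<Rightarrow> bool" where
  "coherent_family T \<psi> \<longleftrightarrow>
     (\<forall>s t. same_level T s t \<longrightarrow> tree_iso (\<psi> s t) (subtree T s) (subtree T t)) \<and>
     (\<forall>s\<in>Field T. \<forall>x\<in>above T s. \<psi> s s x = x) \<and>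
     (\<forall>r s t. same_level T r s \<and> same_level T s t \<longrightarrow>
        (\<forall>x\<in>above T r. \<psi> r t x = \<psi> s t (\<psi> r s x))) \<and>
     (\<forall>r s. same_level T r s \<longrightarrow>
        (\<forall>t\<in>above T r. \<forall>x\<in>above T t. \<psi> t (\<psi> r s t) x = \<psi> r s x)) \<and>
     (\<forall>t u. same_level T t u \<and> limit_ordinal (ht T t) \<longrightarrow>
        (\<exists>\<gamma> :: 'a rel. \<gamma> <o ht T t \<and>
           (\<exists>r \<in> underS T t \<inter> level T \<gamma>. \<exists>s \<in> underS T u \<inter> level T \<gamma>. \<psi> r s t = u)))"

definition strongly_homogeneous :: "'a rel \<Rightarrow> bool" where
  "strongly_homogeneous T \<longleftrightarrow> Souslin_tree T \<and> (\<exists>\<psi>. coherent_family T \<psi>)"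

(* The finite set of nodes serves as its own index set. *)
definition free_tree :: "'a rel \<Rightarrow> bool" where
  "free_tree T \<longleftrightarrow> normal_tree omega1 T \<and>
     (\<forall>F. finite F \<and> F \<noteq> {} \<and> F \<subseteq> Field T \<and> (\<forall>s\<in>F. \<forall>t\<in>F. ht T s =o ht T t) \<longrightarrow>
        ccc (tree_product F (subtree T)))"

end

theory Submission
  imports Defs
begin

text \<open>
  Why the theorem is true. Let \<open>\<psi>\<close> be a coherent family of \<open>T\<close>. By \<open>\<psi>\<close> the immediate successors of
  all nodes on a level \<open>\<beta>\<close> are identified with one another, so colouring the level after \<open>\<beta>\<close> amounts to
  assigning colours to the successors of each single node. Let there be \<open>n\<close> such colourings, with values
  in the natural numbers, for each \<open>\<beta>\<close>. Call two nodes \<open>m\<close>-equivalent if they have the same level and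
  if, at each successor level up to their own, their restrictions have the same \<open>m\<close>-th colour. The
  \<open>m\<close>-th factor is the quotient of \<open>T\<close> by \<open>m\<close>-equivalence.

  Splitting the successors into \<open>\<omega> \<times> \<dots> \<times> \<omega>\<close> in the same way at every node of a level would write \<open>T\<close> as
  a product, but of trees that are homogeneous again, hence not free. The colouring at a node \<open>s\<close>
  is therefore made to depend on \<open>s\<close>: its \<open>m\<close>-th component depends on the \<open>m\<close>-equivalence class of \<open>s\<close> only,
  and subject to this the colourings are as independent as possible (\<open>good_colouring\<close>). Two kinds
  of independence are required. If nodes \<open>s\<^sub>0, \<dots>, s\<^sub>k\<close> of level \<open>\<beta>\<close> are pairwise not \<open>m\<close>-equivalent, then a
  single successor can be found whose copies above the \<open>s\<^sub>i\<close> take any prescribed \<open>m\<close>-th colours. And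
  for \<open>s\<^sub>0, \<dots>, s\<^sub>n\<^sub>-\<^sub>1\<close> arbitrary, some successor takes prescribed \<open>m\<close>-th colours above \<open>s\<^sub>m\<close> for all \<open>m\<close>
  simultaneously, while the colours together determine the successor of a given node. For one level
  this is a combinatorial problem about countable sets, solved in \<open>independent_columns\<close> by
  listing the requirements and meeting each of them with a new column whose other entries are fresh;
  at least two factors are needed so that this never spoils the uniqueness. Since
  \<open>m\<close>-equivalence at level \<open>\<beta>\<close> involves only colours up to \<open>\<beta>\<close>, the colourings are chosen by
  well-founded recursion on \<open>\<beta>\<close>.

  Everything then follows from the lifting lemma \<open>joint_lift\<close>, which extends both kinds of
  independence from one level to all levels: given an admissible family of nodes \<open>r\<^sub>i\<close> on the level
  of \<open>q\<close>, with indices \<open>m\<^sub>i\<close>, and nodes \<open>t\<^sub>i\<close> of one level above them, there is a single \<open>z\<close> above \<open>q\<close> whose copy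
  above \<open>r\<^sub>i\<close> is \<open>m\<^sub>i\<close>-equivalent to \<open>t\<^sub>i\<close> for all \<open>i\<close>. At successor levels this is the independence of the
  colourings. At limit levels coherence makes the \<open>t\<^sub>i\<close> copies of one another from some earlier
  level \<open>\<delta>\<close> on, so the solution at \<open>\<delta>\<close> extends.

  Applied to the root and distinct indices, the lifting lemma shows that \<open>T\<close> maps onto the product of the
  factors (\<open>tree_isomorphic_product\<close>). Applied to one index \<open>m\<close> and finitely many distinct nodes of the
  \<open>m\<close>-th factor, it shows that the tree above \<open>q\<close> maps onto the product of the trees above these nodes
  in the factor; the map preserves the order, so an antichain of the product lifts to an antichain of
  \<open>T\<close>, which is countable (\<open>ccc_factor_product\<close>).
\<close>

section \<open>The countable ordinals as a type\<close>

lemma Card_order_omega1: "Card_order omega1"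
  by (simp add: cardSuc_Card_order natLeq_Card_order)

lemma Well_order_omega1: "Well_order omega1"
  using Card_order_omega1 unfolding card_order_on_def by blast

lemma infinite_Field_omega1: "infinite (Field omega1)"
  using cardSuc_finite[OF natLeq_Card_order] Field_natLeq by simp

lemma omega1_no_top:
  assumes "a \<in> Field omega1" shows "\<exists>b\<in>Field omega1. a \<noteq> b \<and> (a, b) \<in> omega1"
  using infinite_Card_order_limit[OF Card_order_omega1 infinite_Field_omega1 assms] by blast

text \<open>
  Heights of nodes are compared through well-orders up to isomorphism. A type of its own for the ordinals
  below \<open>\<omega>\<^sub>1\<close> turns them into values, with the order and the induction principles of \<^class>\<open>wellorder\<close>.
\<close>

typedef countable_ordinal = "Field omega1"
  using infinite_Field_omega1 by (metis ex_in_conv finite.emptyI)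

instantiation countable_ordinal :: wellorder
begin

definition "x \<le> y \<longleftrightarrow> (Rep_countable_ordinal x, Rep_countable_ordinal y) \<in> omega1"
definition "x < y \<longleftrightarrow> x \<le> y \<and> x \<noteq> (y :: countable_ordinal)"

instance
proof
  fix x y z :: countable_ordinal
  have wo: "trans omega1" "antisym omega1" "total_on (Field omega1) omega1"
      "refl_on (Field omega1) omega1"
    using Well_order_omega1 unfolding order_on_defs by blast+
  show "x \<le> x"
    unfolding less_eq_countable_ordinal_def
    by (rule refl_onD[OF wo(4) Rep_countable_ordinal])
  show "x \<le> y \<Longrightarrow> y \<le> z \<Longrightarrow> x \<le> z"
    unfolding less_eq_countable_ordinal_def by (rule transD[OF wo(1)])
  show anti: "x \<le> y \<Longrightarrow> y \<le> x \<Longrightarrow> x = y"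
    unfolding less_eq_countable_ordinal_def Rep_countable_ordinal_inject[symmetric]
    by (rule antisymD[OF wo(2)])
  show "(x < y) = (x \<le> y \<and> \<not> y \<le> x)"
    unfolding less_countable_ordinal_def using anti \<open>x \<le> x\<close> by blast
  show "x \<le> y \<or> y \<le> x"
  proof (cases "x = y")
    case False
    then show ?thesis
      unfolding less_eq_countable_ordinal_def
      using wo(3) Rep_countable_ordinal[of x] Rep_countable_ordinal[of y]
        Rep_countable_ordinal_inject[of x y]
      unfolding total_on_def by blast
  qed (use \<open>x \<le> x\<close> in blast)
next
  fix P :: "countable_ordinal \<Rightarrow> bool" and a
  assume step: "\<And>x. (\<And>y. y < x \<Longrightarrow> P y) \<Longrightarrow> P x"
  have "wf (omega1 - Id)"
    using Well_order_omega1 unfolding order_on_defs by blast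
  then have "wf (inv_image (omega1 - Id) Rep_countable_ordinal)"
    by (rule wf_inv_image)
  then show "P a"
  proof (induction a rule: wf_induct_rule)
    case (less x)
    show ?case
      by (rule step, rule less)
        (auto simp: less_countable_ordinal_def less_eq_countable_ordinal_def
          Rep_countable_ordinal_inject)
  qed
qed

end

instance countable_ordinal :: no_top
proof
  fix x :: countable_ordinal
  obtain b where "b \<in> Field omega1" "Rep_countable_ordinal x \<noteq> b" "(Rep_countable_ordinal x, b) \<in> omega1"
    using omega1_no_top[OF Rep_countable_ordinal] by blast
  then have "x < Abs_countable_ordinal b"
    by (auto simp: less_countable_ordinal_def less_eq_countable_ordinal_def
        Abs_countable_ordinal_inverse)
  then show "\<exists>y. x < y" ..
qed

definition osuc :: "countable_ordinal \<Rightarrow> countable_ordinal" where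
  "osuc \<beta> = (LEAST \<gamma>. \<beta> < \<gamma>)"

lemma less_osuc [simp]: "\<beta> < osuc \<beta>"
  unfolding osuc_def using gt_ex by (rule LeastI_ex)

lemma osuc_le_iff [simp]: "osuc \<beta> \<le> \<gamma> \<longleftrightarrow> \<beta> < \<gamma>"
  using less_osuc[of \<beta>] Least_le[of "\<lambda>\<gamma>. \<beta> < \<gamma>" \<gamma>] unfolding osuc_def by (auto intro: less_le_trans)

lemma less_osuc_iff [simp]: "\<gamma> < osuc \<beta> \<longleftrightarrow> \<gamma> \<le> \<beta>"
  using osuc_le_iff[of \<beta> \<gamma>] by (meson not_le)

lemma osuc_neq [simp]: "osuc \<beta> \<noteq> \<beta>" "\<beta> \<noteq> osuc \<beta>"
  using less_osuc[of \<beta>] by (metis less_irrefl)+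

lemma osuc_inject [simp]: "osuc \<beta> = osuc \<gamma> \<longleftrightarrow> \<beta> = \<gamma>"
  by (metis less_osuc less_osuc_iff order_antisym)

lemma limit_osuc_less: "(\<And>\<beta>. \<eta> \<noteq> osuc \<beta>) \<Longrightarrow> \<gamma> < \<eta> \<Longrightarrow> osuc \<gamma> < \<eta>"
  by (metis order_le_less osuc_le_iff)

definition ordinals :: "countable_ordinal rel" where
  "ordinals = {(x, y). x \<le> y}"

text \<open>
  The well-order that represents the ordinal \<open>\<beta>\<close>; it is a proper initial segment of
  \<open>ordinals\<close>, which has the type of \<open>\<omega>\<^sub>1\<close>.
\<close>

definition seg :: "countable_ordinal \<Rightarrow> countable_ordinal rel" where
  "seg \<beta> = {(x, y). x \<le> y \<and> y < \<beta>}"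

lemma Field_ordinals [simp]: "Field ordinals = UNIV"
  by (auto simp: ordinals_def Field_def)

lemma Field_seg [simp]: "Field (seg \<beta>) = {..<\<beta>}"
  by (auto simp: seg_def Field_def)

lemma Well_order_ordinals: "Well_order ordinals"
proof -
  have "ordinals - Id = {(x, y). x < y}"
    by (auto simp: ordinals_def)
  then have "wf (ordinals - Id)"
    using wf by simp
  then show ?thesis
    unfolding order_on_defs Field_ordinals
    by (auto simp: ordinals_def refl_on_def trans_def antisym_def total_on_def)
qed

lemma ordinals_ordIso_omega1: "ordinals =o omega1"
proof -
  have "bij_betw Rep_countable_ordinal UNIV (Field omega1)"
    unfolding bij_betw_def
    using type_definition.Rep_range[OF type_definition_countable_ordinal]
    by (auto simp: inj_def Rep_countable_ordinal_inject)
  then have "iso ordinals omega1 Rep_countable_ordinal"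
    unfolding iso_iff2 Field_ordinals
    by (auto simp: ordinals_def less_eq_countable_ordinal_def)
  then show ?thesis
    unfolding ordIso_def using Well_order_ordinals Well_order_omega1 by blast
qed

lemma seg_eq_Restr: "seg \<beta> = Restr ordinals (underS ordinals \<beta>)"
  by (auto simp: seg_def ordinals_def underS_def)

lemma seg_eq_Restr_seg:
  assumes "\<beta> < \<gamma>" shows "seg \<beta> = Restr (seg \<gamma>) (underS (seg \<gamma>) \<beta>)"
  using assms by (auto simp: seg_def underS_def)

lemma Well_order_seg: "Well_order (seg \<beta>)"
  unfolding seg_eq_Restr by (rule Well_order_Restr[OF Well_order_ordinals])

lemma seg_ordLess_omega1: "seg \<beta> <o omega1"
  using underS_Restr_ordLess[OF Well_order_ordinals, of \<beta>] ordinals_ordIso_omega1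
  unfolding seg_eq_Restr by (simp add: ordLess_ordIso_trans)

lemma seg_mono: "\<beta> < \<gamma> \<Longrightarrow> seg \<beta> <o seg \<gamma>"
  using underS_Restr_ordLess[OF Well_order_seg[of \<gamma>], of \<beta>] seg_eq_Restr_seg[of \<beta> \<gamma>]
  by (metis Field_seg empty_iff lessThan_iff)

lemma seg_ordIso_iff [simp]: "seg \<beta> =o seg \<gamma> \<longleftrightarrow> \<beta> = \<gamma>"
proof (cases \<beta> \<gamma> rule: linorder_cases)
  case less
  then show ?thesis using not_ordLess_ordIso[OF seg_mono] by blast
next
  case equal
  then show ?thesis using ordIso_reflexive[OF Well_order_seg] by simp
next
  case greater
  then show ?thesis using not_ordLess_ordIso[OF seg_mono] ordIso_symmetric by blast
qed

lemma seg_ordLess_iff [simp]: "seg \<beta> <o seg \<gamma> \<longleftrightarrow> \<beta> < \<gamma>"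
proof (cases \<beta> \<gamma> rule: linorder_cases)
  case less
  then show ?thesis using seg_mono by blast
next
  case equal
  then show ?thesis using ordLess_irreflexive by blast
next
  case greater
  then show ?thesis using seg_mono ordLess_transitive ordLess_irreflexive by (meson not_less_iff_gr_or_eq)
qed

lemma ordLess_omega1_seg:
  assumes "\<alpha> <o omega1" obtains \<beta> where "\<alpha> =o seg \<beta>"
proof -
  have "\<alpha> <o ordinals"
    using assms ordinals_ordIso_omega1 ordIso_symmetric ordLess_ordIso_trans by blast
  moreover from this have "Well_order \<alpha>"
    by (simp add: ordLess_def)
  ultimately obtain \<beta> where "\<alpha> =o seg \<beta>"
    using ordLess_iff_ordIso_Restr[OF Well_order_ordinals] unfolding seg_eq_Restr by blast
  then show ?thesis by (rule that)
qed

text \<open>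
  Left cancellation for ordinal addition, in terms of intervals. It recovers the level of a node of
  a subtree from its height in the subtree.
\<close>

lemma Restr_seg_interval_inject:
  assumes "Restr (seg \<gamma>) {\<beta>..<\<gamma>} =o Restr (seg \<gamma>') {\<beta>..<\<gamma>'}" "\<beta> \<le> \<gamma>" "\<beta> \<le> \<gamma>'"
  shows "\<gamma> = \<gamma>'"
proof -
  have shorter: "Restr (seg \<gamma>) {\<beta>..<\<gamma>} <o Restr (seg \<gamma>') {\<beta>..<\<gamma>'}" if "\<beta> \<le> \<gamma>" "\<gamma> < \<gamma>'" for \<gamma> \<gamma>'
  proof -
    let ?R = "Restr (seg \<gamma>') {\<beta>..<\<gamma>'}"
    have "(\<gamma>, \<gamma>) \<in> ?R"
      using that by (simp add: seg_def)
    from FieldI1[OF this] have "Field ?R \<noteq> {}"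
      by (rule ex_in_conv[THEN iffD1, OF exI])
    moreover have "Restr ?R (underS ?R \<gamma>) = Restr (seg \<gamma>) {\<beta>..<\<gamma>}"
      using that by (auto simp: seg_def underS_def)
    ultimately show ?thesis
      using underS_Restr_ordLess[OF Well_order_Restr[OF Well_order_seg], of \<gamma>' "{\<beta>..<\<gamma>'}" \<gamma>] by simp
  qed
  show ?thesis
  proof (cases \<gamma> \<gamma>' rule: linorder_cases)
    case less
    then show ?thesis
      using not_ordLess_ordIso[OF shorter] assms by blast
  next
    case greater
    then show ?thesis
      using not_ordLess_ordIso[OF shorter] ordIso_symmetric[OF assms(1)] assms by blast
  qed
qed

lemma limit_ordinal_seg:
  "limit_ordinal (seg \<beta>) \<longleftrightarrow> (\<exists>\<gamma>. \<gamma> < \<beta>) \<and> (\<forall>\<gamma>. \<beta> \<noteq> osuc \<gamma>)"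
proof -
  have mem: "(a, b) \<in> seg \<beta> \<longleftrightarrow> a \<le> b \<and> b < \<beta>" for a b
    by (simp add: seg_def)
  have "limit_ordinal (seg \<beta>) \<longleftrightarrow> (\<exists>\<gamma>. \<gamma> < \<beta>) \<and> (\<forall>\<gamma><\<beta>. \<exists>\<delta><\<beta>. \<gamma> < \<delta>)"
    using Well_order_seg[of \<beta>] mem unfolding limit_ordinal_def Field_seg
    by (simp add: less_le Bex_def lessThan_def) (metis (no_types, lifting))
  also have "\<dots> \<longleftrightarrow> (\<exists>\<gamma>. \<gamma> < \<beta>) \<and> (\<forall>\<gamma>. \<beta> \<noteq> osuc \<gamma>)"
    by (metis limit_osuc_less less_osuc less_osuc_iff not_less)
  finally show ?thesis .
qed

lemma limit_ordinal_ordIso: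
  assumes "\<alpha> =o \<beta>" "limit_ordinal \<beta>" shows "limit_ordinal \<alpha>"
proof -
  obtain f where f: "Well_order \<alpha>" "iso \<alpha> \<beta> f"
    using assms(1) by (auto simp: ordIso_def)
  then have b: "bij_betw f (Field \<alpha>) (Field \<beta>)"
      and i: "\<And>a b. a \<in> Field \<alpha> \<Longrightarrow> b \<in> Field \<alpha> \<Longrightarrow> (a, b) \<in> \<alpha> \<longleftrightarrow> (f a, f b) \<in> \<beta>"
    by (auto simp: iso_iff2)
  have "\<exists>b\<in>Field \<alpha>. a \<noteq> b \<and> (a, b) \<in> \<alpha>" if a: "a \<in> Field \<alpha>" for a
  proof -
    obtain c where "c \<in> Field \<beta>" "f a \<noteq> c" "(f a, c) \<in> \<beta>"
      using assms(2) a bij_betwE[OF b] by (auto simp: limit_ordinal_def)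
    moreover from this obtain d where "d \<in> Field \<alpha>" "c = f d"
      using bij_betw_imp_surj_on[OF b] by blast
    ultimately show ?thesis
      using i[OF a, of d] by (intro bexI[of _ d]) auto
  qed
  moreover have "Field \<alpha> \<noteq> {}"
    using b assms(2) by (auto simp: limit_ordinal_def bij_betw_def)
  ultimately show ?thesis
    using f(1) by (auto simp: limit_ordinal_def)
qed

section \<open>Trees with a level function\<close>

text \<open>
  A tree of height at most \<open>\<omega>\<^sub>1\<close> with the heights given as values \<open>lv t\<close>. The axioms say that \<open>lv\<close> maps the
  predecessors of \<open>t\<close> isomorphically to the ordinals below \<open>lv t\<close>.
\<close>

locale level_tree =
  fixes T :: "'a rel" and lv :: "'a \<Rightarrow> countable_ordinal"
  assumes po: "Partial_order T"
    and lv_less: "(s, t) \<in> T \<Longrightarrow> s \<noteq> t \<Longrightarrow> lv s < lv t"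
    and pred_ex: "t \<in> Field T \<Longrightarrow> \<beta> \<le> lv t \<Longrightarrow> \<exists>s. (s, t) \<in> T \<and> lv s = \<beta>"
    and pred_unique: "(s, t) \<in> T \<Longrightarrow> (s', t) \<in> T \<Longrightarrow> lv s = lv s' \<Longrightarrow> s = s'"
begin

definition res :: "'a \<Rightarrow> countable_ordinal \<Rightarrow> 'a" where
  "res t \<beta> = (THE s. (s, t) \<in> T \<and> lv s = \<beta>)"

definition succs :: "'a \<Rightarrow> 'a set" where
  "succs s = {t. (s, t) \<in> T \<and> lv t = osuc (lv s)}"

lemma T_refl: "s \<in> Field T \<Longrightarrow> (s, s) \<in> T"
  using po unfolding order_on_defs refl_on_def by blast

lemma T_trans: "(s, t) \<in> T \<Longrightarrow> (t, u) \<in> T \<Longrightarrow> (s, u) \<in> T"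
  using po unfolding order_on_defs trans_def by blast

lemma T_antisym: "(s, t) \<in> T \<Longrightarrow> (t, s) \<in> T \<Longrightarrow> s = t"
  using po unfolding order_on_defs antisym_def by blast

lemma T_Field: "(s, t) \<in> T \<Longrightarrow> s \<in> Field T" "(s, t) \<in> T \<Longrightarrow> t \<in> Field T"
  by (auto simp: Field_def)

lemma lv_le: "(s, t) \<in> T \<Longrightarrow> lv s \<le> lv t"
  using lv_less by (cases "s = t") (auto intro: less_imp_le)

lemma same_lv_eq: "(s, t) \<in> T \<Longrightarrow> lv s = lv t \<Longrightarrow> s = t"
  using lv_less by fastforce

lemma res:
  assumes "t \<in> Field T" "\<beta> \<le> lv t"
  shows "(res t \<beta>, t) \<in> T" "lv (res t \<beta>) = \<beta>" "res t \<beta> \<in> Field T"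
proof -
  have "\<exists>!s. (s, t) \<in> T \<and> lv s = \<beta>"
    using pred_ex[OF assms] pred_unique by blast
  then have "(res t \<beta>, t) \<in> T \<and> lv (res t \<beta>) = \<beta>"
    unfolding res_def by (rule theI')
  then show "(res t \<beta>, t) \<in> T" "lv (res t \<beta>) = \<beta>" "res t \<beta> \<in> Field T"
    by (auto simp: Field_def)
qed

lemma res_eq: "(s, t) \<in> T \<Longrightarrow> res t (lv s) = s"
  using res[of t "lv s"] pred_unique T_Field lv_le by metis

lemma res_self: "t \<in> Field T \<Longrightarrow> res t (lv t) = t"
  by (simp add: T_refl res_eq)

lemma res_le: "(s, t) \<in> T \<Longrightarrow> lv s \<le> \<beta> \<Longrightarrow> \<beta> \<le> lv t \<Longrightarrow> (s, res t \<beta>) \<in> T"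
proof -
  assume *: "(s, t) \<in> T" "lv s \<le> \<beta>" "\<beta> \<le> lv t"
  note t = T_Field(2)[OF *(1)]
  note r = res[OF t *(3)]
  have "(res (res t \<beta>) (lv s), res t \<beta>) \<in> T" "lv (res (res t \<beta>) (lv s)) = lv s"
    using res[OF r(3)] *(2) r(2) by auto
  then have "res (res t \<beta>) (lv s) = s"
    using pred_unique[OF _ *(1)] T_trans r(1) by blast
  then show ?thesis
    using \<open>(res (res t \<beta>) (lv s), res t \<beta>) \<in> T\<close> by simp
qed

lemma res_mono: "t \<in> Field T \<Longrightarrow> \<beta> \<le> \<gamma> \<Longrightarrow> \<gamma> \<le> lv t \<Longrightarrow> (res t \<beta>, res t \<gamma>) \<in> T"
  using res_le[of "res t \<beta>" t \<gamma>] res[of t \<beta>] by auto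

lemma res_res: "t \<in> Field T \<Longrightarrow> \<beta> \<le> \<gamma> \<Longrightarrow> \<gamma> \<le> lv t \<Longrightarrow> res (res t \<gamma>) \<beta> = res t \<beta>"
  using res_eq[OF res_mono[of t \<beta> \<gamma>]] res[of t \<beta>] by auto

lemma res_below: "(s, t) \<in> T \<Longrightarrow> \<beta> \<le> lv s \<Longrightarrow> res t \<beta> = res s \<beta>"
  using res_res[of t \<beta> "lv s"] res_eq[of s t] lv_le[of s t] T_Field by metis

lemma linear_below: "(s, t) \<in> T \<Longrightarrow> (s', t) \<in> T \<Longrightarrow> (s, s') \<in> T \<longleftrightarrow> lv s \<le> lv s'"
  using res_le[of s t "lv s'"] res_eq[of s' t] lv_le by metis

lemma lv_underS: "t \<in> Field T \<Longrightarrow> lv ` underS T t = {..<lv t}"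
proof (intro equalityI subsetI)
  fix \<beta> assume t: "t \<in> Field T" and "\<beta> \<in> {..<lv t}"
  then have "(res t \<beta>, t) \<in> T" "lv (res t \<beta>) = \<beta>" "res t \<beta> \<noteq> t"
    using res[of t \<beta>] by (auto simp: less_imp_le)
  then show "\<beta> \<in> lv ` underS T t"
    unfolding underS_def by (intro rev_image_eqI[of "res t \<beta>"]) auto
qed (auto simp: underS_def lv_less)

lemma inj_on_lv_below: "inj_on lv {s. (s, t) \<in> T}"
  using pred_unique by (auto simp: inj_on_def)

lemma Well_order_below:
  assumes "A \<subseteq> {s. (s, t) \<in> T}"
  shows "Well_order (Restr T A)" "Field (Restr T A) = A"
proof -
  have F: "Field (Restr T A) = A"
    using assms T_refl T_Field by (auto simp: Field_def)
  have "Restr T A - Id \<subseteq> inv_image {(x, y). x < y} lv"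
    by (auto dest: lv_less)
  then have "wf (Restr T A - Id)"
    using wf_inv_image[OF wf] wf_subset by blast
  moreover have "refl_on A (Restr T A)"
    using assms T_refl T_Field by (intro refl_onI) auto
  moreover have "trans (Restr T A)"
    by (intro transI) (auto intro: T_trans)
  moreover have "antisym (Restr T A)"
    by (intro antisymI) (auto intro: T_antisym)
  moreover have "total_on A (Restr T A)"
    unfolding total_on_def
  proof (intro ballI impI)
    fix x y assume xy: "x \<in> A" "y \<in> A"
    then have "(x, t) \<in> T" "(y, t) \<in> T"
      using assms by auto
    then have "(x, y) \<in> T \<or> (y, x) \<in> T"
      using linear_below by (metis linear)
    then show "(x, y) \<in> Restr T A \<or> (y, x) \<in> Restr T A"
      using xy by auto
  qed
  ultimately show "Well_order (Restr T A)"
    unfolding order_on_defs F by (intro conjI) auto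
  show "Field (Restr T A) = A" by (rule F)
qed

text \<open>
  Any set of nodes below \<open>t\<close> is a chain on which \<open>lv\<close> is strictly increasing, so its order type can
  be read off from the levels. This carries every statement about heights over to \<open>lv\<close>.
\<close>

lemma ordIso_below:
  assumes A: "A \<subseteq> {s. (s, t) \<in> T}" and B: "B \<subseteq> {..<\<beta>}" "lv ` A = B"
  shows "Restr T A =o Restr (seg \<beta>) B"
proof -
  have F: "Field (Restr (seg \<beta>) B) = B"
    using B(1) by (auto simp: seg_def Field_def)
  have "bij_betw lv A B"
    using inj_on_subset[OF inj_on_lv_below A] B(2) by (simp add: bij_betw_def)
  moreover have "(s, s') \<in> Restr T A \<longleftrightarrow> (lv s, lv s') \<in> Restr (seg \<beta>) B"
    if "s \<in> A" "s' \<in> A" for s s'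
    using linear_below[of s t s'] that A B by (auto simp: seg_def)
  ultimately have "iso (Restr T A) (Restr (seg \<beta>) B) lv"
    unfolding iso_iff2 F Well_order_below(2)[OF A] by blast
  then show ?thesis
    unfolding ordIso_def
    using Well_order_below(1)[OF A] Well_order_Restr[OF Well_order_seg] by blast
qed

lemma ht_ordIso_seg: "t \<in> Field T \<Longrightarrow> ht T t =o seg (lv t)"
proof -
  assume t: "t \<in> Field T"
  have "Restr (seg (lv t)) {..<lv t} = seg (lv t)"
    by (auto simp: seg_def)
  then show ?thesis
    using ordIso_below[of "underS T t" t "{..<lv t}" "lv t"] lv_underS[OF t]
    unfolding ht_def by (auto simp: underS_def)
qed

lemma tree: "tree T"
  unfolding tree_def
proof (intro conjI ballI)
  fix t assume "t \<in> Field T"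
  then show "well_order_on (underS T t) (Restr T (underS T t))"
    using Well_order_below[of "underS T t" t] by (auto simp: underS_def)
qed (rule po)

lemma ht_ordIso_iff: "s \<in> Field T \<Longrightarrow> ht T s =o seg \<beta> \<longleftrightarrow> lv s = \<beta>"
  using ht_ordIso_seg[of s] by (metis ordIso_symmetric ordIso_transitive seg_ordIso_iff)

lemma same_height_iff:
  "s \<in> Field T \<Longrightarrow> t \<in> Field T \<Longrightarrow> ht T s =o ht T t \<longleftrightarrow> lv s = lv t"
  using ht_ordIso_seg ht_ordIso_iff by (metis ordIso_symmetric ordIso_transitive)

lemma ht_ordLess_iff: "s \<in> Field T \<Longrightarrow> t \<in> Field T \<Longrightarrow> ht T s <o ht T t \<longleftrightarrow> lv s < lv t"
  using ht_ordIso_seg[of s] ht_ordIso_seg[of t] seg_ordLess_iff[of "lv s" "lv t"]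
  by (metis ordIso_symmetric ordIso_ordLess_trans ordLess_ordIso_trans)

lemma level_seg: "level T (seg \<beta>) = {t \<in> Field T. lv t = \<beta>}"
  using ht_ordIso_iff by (auto simp: level_def)

lemma level_cong:
  assumes "\<alpha> =o \<alpha>'" shows "level T \<alpha> = level T \<alpha>'"
proof -
  have "ht T t =o \<alpha> \<longleftrightarrow> ht T t =o \<alpha>'" for t
    using ordIso_transitive[OF _ assms] ordIso_transitive[OF _ ordIso_symmetric[OF assms]] by blast
  then show ?thesis
    unfolding level_def by simp
qed

lemma level_eq:
  assumes "t \<in> level T \<alpha>" shows "level T \<alpha> = {s \<in> Field T. lv s = lv t}"
proof -
  have "t \<in> Field T" "\<alpha> =o ht T t"
    using assms ordIso_symmetric by (auto simp: level_def)
  then have "\<alpha> =o seg (lv t)"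
    using ht_ordIso_seg ordIso_transitive by blast
  from level_cong[OF this] show ?thesis
    by (simp only: level_seg)
qed

lemma limit_ordinal_ht:
  assumes "t \<in> Field T"
  shows "limit_ordinal (ht T t) \<longleftrightarrow> (\<exists>\<gamma>. \<gamma> < lv t) \<and> (\<forall>\<gamma>. lv t \<noteq> osuc \<gamma>)"
  using limit_ordinal_ordIso[OF ht_ordIso_seg[OF assms]]
    limit_ordinal_ordIso[OF ordIso_symmetric[OF ht_ordIso_seg[OF assms]]]
  unfolding limit_ordinal_seg by blast

text \<open>
  If \<open>t\<close> is above \<open>s\<close>, the restriction of \<open>t\<close> to the level after that of \<open>s\<close> lies between them.
\<close>

lemma immediate_successors_eq: "immediate_successors T s = succs s"
proof (intro equalityI subsetI)
  fix t assume t: "t \<in> immediate_successors T s"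
  then have st: "(s, t) \<in> T" "s \<noteq> t"
    by (auto simp: immediate_successors_def aboveS_def)
  then have le: "osuc (lv s) \<le> lv t"
    using lv_less by simp
  define u where "u = res t (osuc (lv s))"
  note u = res[OF T_Field(2)[OF st(1)] le, folded u_def]
  have "(s, u) \<in> T"
    unfolding u_def by (rule res_le[OF st(1) _ le]) (simp add: less_imp_le)
  moreover have "s \<noteq> u"
    using u(2) by auto
  ultimately have "u = t"
    using t u(1) by (auto simp: immediate_successors_def aboveS_def)
  then show "t \<in> succs s"
    using st u by (auto simp: succs_def)
next
  fix t assume t: "t \<in> succs s"
  then have "s \<noteq> t"
    by (auto simp: succs_def)
  moreover have False if "(s, u) \<in> T" "s \<noteq> u" "(u, t) \<in> T" "u \<noteq> t" for u
    using lv_less[OF that(1,2)] lv_less[OF that(3,4)] t by (auto simp: succs_def)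
  ultimately show "t \<in> immediate_successors T s"
    using t by (auto simp: succs_def immediate_successors_def aboveS_def)
qed

lemma antichain_level: "antichain T {t \<in> Field T. lv t = \<beta>}"
  using lv_less by (fastforce simp: antichain_def)

lemma Field_subtree: "s \<in> Field T \<Longrightarrow> Field (subtree T s) = above T s"
  using T_refl T_Field by (auto simp: subtree_def above_def Field_def)

text \<open>
  Passing to the tree above \<open>s\<close> removes the levels below \<open>lv s\<close>, whence the interval.
\<close>

lemma ht_subtree:
  assumes sx: "(s, x) \<in> T"
  shows "ht (subtree T s) x =o Restr (seg (lv x)) {lv s..<lv x}"
proof -
  define A where "A = {y. (s, y) \<in> T \<and> (y, x) \<in> T \<and> y \<noteq> x}"
  have "ht (subtree T s) x = Restr T A"
    using sx T_trans unfolding ht_def subtree_def underS_def above_def A_def by blast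
  moreover have "lv ` A = {lv s..<lv x}"
  proof (intro equalityI subsetI)
    fix \<beta> assume "\<beta> \<in> {lv s..<lv x}"
    then have \<beta>: "lv s \<le> \<beta>" "\<beta> \<le> lv x" "\<beta> \<noteq> lv x"
      by auto
    have "(s, res x \<beta>) \<in> T" "(res x \<beta>, x) \<in> T" "lv (res x \<beta>) = \<beta>"
      using res_le[OF sx \<beta>(1,2)] res[OF T_Field(2)[OF sx] \<beta>(2)] by simp_all
    moreover from this have "res x \<beta> \<noteq> x"
      using \<beta>(3) by auto
    ultimately show "\<beta> \<in> lv ` A"
      unfolding A_def by (intro rev_image_eqI[of "res x \<beta>"]) auto
  qed (auto simp: A_def lv_less lv_le)
  moreover have "A \<subseteq> {y. (y, x) \<in> T}" "{lv s..<lv x} \<subseteq> {..<lv x}"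
    by (auto simp: A_def)
  ultimately show ?thesis
    using ordIso_below[of A x "{lv s..<lv x}" "lv x"] by simp
qed

lemma subtree_levels:
  assumes s: "s \<in> Field T" "s' \<in> Field T" "lv s = lv s'"
    and x: "x \<in> level (subtree T s) \<alpha>" "x' \<in> level (subtree T s') \<alpha>"
  shows "(s, x) \<in> T" "lv x = lv x'"
proof -
  have xT: "(s, x) \<in> T" "(s', x') \<in> T"
    using x Field_subtree s by (auto simp: level_def above_def)
  have h: "ht (subtree T s) x =o \<alpha>" "ht (subtree T s') x' =o \<alpha>"
    using x by (simp_all add: level_def)
  have "Restr (seg (lv x)) {lv s..<lv x} =o Restr (seg (lv x')) {lv s..<lv x'}"
    using ordIso_transitive[OF ordIso_transitive[OF ordIso_symmetric[OF ht_subtree[OF xT(1)]] h(1)]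
        ordIso_transitive[OF ordIso_symmetric[OF h(2)] ht_subtree[OF xT(2)]]] s(3)
    by simp
  then show "lv x = lv x'"
    by (rule Restr_seg_interval_inject) (use lv_le[OF xT(1)] lv_le[OF xT(2)] s(3) in simp_all)
  show "(s, x) \<in> T" by (rule xT)
qed

end

text \<open>
  No node has uncountable height: otherwise the node itself or one of its predecessors would have height
  exactly \<open>\<omega>\<^sub>1\<close>, but that level is empty.
\<close>

lemma level_tree_exists:
  assumes "tree T" "has_height T omega1"
  obtains lv where "level_tree T lv"
proof -
  have po: "Partial_order T"
    and wo: "\<And>t. t \<in> Field T \<Longrightarrow> well_order_on (underS T t) (ht T t)"
    using assms(1) by (auto simp: tree_def ht_def)
  have Fht: "Field (ht T t) = underS T t" if "t \<in> Field T" for t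
    using well_order_on_Field[OF wo[OF that]] by simp
  have Wht: "Well_order (ht T t)" if "t \<in> Field T" for t
    using wo[OF that] Fht[OF that] by simp
  have tr: "\<And>s t u. (s, t) \<in> T \<Longrightarrow> (t, u) \<in> T \<Longrightarrow> (s, u) \<in> T"
    and anti: "\<And>s t. (s, t) \<in> T \<Longrightarrow> (t, s) \<in> T \<Longrightarrow> s = t"
    using po unfolding order_on_defs trans_def antisym_def by blast+
  have ht_below: "ht T s = Restr (ht T t) (underS (ht T t) s)" if "s \<in> underS T t" for s t
    using that tr anti unfolding ht_def underS_def by blast
  have countable_ht: "ht T t <o omega1" if t: "t \<in> Field T" for t
  proof (rule ccontr)
    assume "\<not> ht T t <o omega1"
    then have "omega1 \<le>o ht T t"
      using not_ordLess_iff_ordLeq[OF Well_order_omega1 Wht[OF t]] by blast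
    then consider "omega1 <o ht T t" | "omega1 =o ht T t"
      using ordLeq_iff_ordLess_or_ordIso by blast
    then obtain s where "s \<in> Field T" "omega1 =o ht T s"
    proof cases
      case 1
      then obtain s where "s \<in> underS T t" "omega1 =o ht T s"
        using ordLess_iff_ordIso_Restr[OF Wht[OF t] Well_order_omega1] Fht[OF t] ht_below
        by metis
      then show ?thesis
        using that by (auto simp: underS_def Field_def)
    qed (use t that in blast)
    then have "s \<in> level T omega1"
      using ordIso_symmetric by (auto simp: level_def)
    then show False
      using assms(2) by (auto simp: has_height_def)
  qed
  define lv where "lv t = (SOME \<beta>. ht T t =o seg \<beta>)" for t
  have lv: "ht T t =o seg (lv t)" if "t \<in> Field T" for t
    unfolding lv_def using ordLess_omega1_seg[OF countable_ht[OF that]] by (metis someI)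
  have lv_less: "lv s < lv t" if "(s, t) \<in> T" "s \<noteq> t" for s t
  proof -
    have st: "s \<in> Field T" "t \<in> Field T" "s \<in> underS T t"
      using that by (auto simp: Field_def underS_def)
    then have "ht T s <o ht T t"
      using underS_Restr_ordLess[OF Wht[OF st(2)]] Fht[OF st(2)] ht_below[OF st(3)]
      by (metis empty_iff)
    then have "seg (lv s) <o seg (lv t)"
      using ordIso_ordLess_trans[OF ordIso_symmetric[OF lv[OF st(1)]]]
        ordLess_ordIso_trans[OF _ lv[OF st(2)]] by blast
    then show ?thesis by simp
  qed
  have "level_tree T lv"
  proof
    show "Partial_order T" by (rule po)
    show "\<And>s t. (s, t) \<in> T \<Longrightarrow> s \<noteq> t \<Longrightarrow> lv s < lv t" by (rule lv_less)
  next
    fix t \<beta> assume t: "t \<in> Field T" and \<beta>: "\<beta> \<le> lv t"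
    show "\<exists>s. (s, t) \<in> T \<and> lv s = \<beta>"
    proof (cases "\<beta> = lv t")
      case True
      then show ?thesis
        using t po unfolding order_on_defs refl_on_def by blast
    next
      case False
      then have "seg \<beta> <o ht T t"
        using \<beta> ordLess_ordIso_trans[OF seg_mono ordIso_symmetric[OF lv[OF t]]] by simp
      then obtain s where s: "s \<in> underS T t" "seg \<beta> =o ht T s"
        using ordLess_iff_ordIso_Restr[OF Wht[OF t] Well_order_seg] Fht[OF t] ht_below by metis
      then have "s \<in> Field T" "(s, t) \<in> T"
        by (auto simp: underS_def Field_def)
      moreover have "seg \<beta> =o seg (lv s)"
        using ordIso_transitive[OF s(2) lv[OF \<open>s \<in> Field T\<close>]] .
      ultimately show ?thesis by auto
    qed
  next
    fix s t s' assume *: "(s, t) \<in> T" "(s', t) \<in> T" "lv s = lv s'"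
    have t: "t \<in> Field T" using * by (auto simp: Field_def)
    have "(s, s') \<in> T \<or> (s', s) \<in> T \<or> s = s'"
    proof (cases "s = t \<or> s' = t")
      case False
      then have "s \<in> underS T t" "s' \<in> underS T t"
        using * by (auto simp: underS_def)
      then show ?thesis
        using wo[OF t] unfolding order_on_defs total_on_def ht_def by blast
    qed (use * in auto)
    then show "s = s'"
      using lv_less *(3) by fastforce
  qed
  then show ?thesis by (rule that)
qed

text \<open>
  With a common level function, the height of any one component of a tuple of nodes with equal levels
  represents the level of all components.
\<close>

lemma tree_product_nodes:
  fixes S :: "'i \<Rightarrow> 'a rel"
  assumes S: "\<And>i. i \<in> I \<Longrightarrow> level_tree (S i) lv" and "I \<noteq> {}"
  shows "(\<Union>\<alpha> :: 'a rel. \<Pi>\<^sub>E i\<in>I. level (S i) \<alpha>) =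
    {f \<in> (\<Pi>\<^sub>E i\<in>I. Field (S i)). \<forall>i\<in>I. \<forall>j\<in>I. lv (f i) = lv (f j)}"
proof (intro equalityI subsetI)
  fix f assume "f \<in> (\<Union>\<alpha> :: 'a rel. \<Pi>\<^sub>E i\<in>I. level (S i) \<alpha>)"
  then obtain \<alpha> :: "'a rel" where f: "f \<in> (\<Pi>\<^sub>E i\<in>I. level (S i) \<alpha>)"
    by blast
  then have fi: "f i \<in> Field (S i)" "ht (S i) (f i) =o \<alpha>" if "i \<in> I" for i
    using that by (auto simp: level_def dest: PiE_mem)
  have seg: "ht (S i) (f i) =o seg (lv (f i))" if "i \<in> I" for i
    by (rule level_tree.ht_ordIso_seg[OF S[OF that] fi(1)[OF that]])
  have "f \<in> (\<Pi>\<^sub>E i\<in>I. Field (S i))"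
    using f fi(1) by (auto simp: PiE_iff)
  moreover have "lv (f i) = lv (f j)" if ij: "i \<in> I" "j \<in> I" for i j
  proof -
    have "seg (lv (f i)) =o seg (lv (f j))"
      using ordIso_transitive[OF ordIso_transitive[OF ordIso_symmetric[OF seg[OF ij(1)]] fi(2)[OF ij(1)]]
        ordIso_transitive[OF ordIso_symmetric[OF fi(2)[OF ij(2)]] seg[OF ij(2)]]] .
    then show ?thesis by simp
  qed
  ultimately show "f \<in> {f \<in> (\<Pi>\<^sub>E i\<in>I. Field (S i)). \<forall>i\<in>I. \<forall>j\<in>I. lv (f i) = lv (f j)}"
    by blast
next
  fix f assume "f \<in> {f \<in> (\<Pi>\<^sub>E i\<in>I. Field (S i)). \<forall>i\<in>I. \<forall>j\<in>I. lv (f i) = lv (f j)}"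
  then have f: "f \<in> extensional I" "\<And>i. i \<in> I \<Longrightarrow> f i \<in> Field (S i)"
    and lv: "\<And>i j. i \<in> I \<Longrightarrow> j \<in> I \<Longrightarrow> lv (f i) = lv (f j)"
    unfolding PiE_iff by blast+
  obtain i0 where i0: "i0 \<in> I" using \<open>I \<noteq> {}\<close> by blast
  define \<alpha> where "\<alpha> = ht (S i0) (f i0)"
  have "ht (S i) (f i) =o \<alpha>" if i: "i \<in> I" for i
  proof -
    have "ht (S i) (f i) =o seg (lv (f i0))"
      using level_tree.ht_ordIso_seg[OF S[OF i] f(2)[OF i]] lv[OF i i0] by simp
    then show ?thesis
      unfolding \<alpha>_def
      by (rule ordIso_transitive[OF _ ordIso_symmetric[OF level_tree.ht_ordIso_seg[OF S[OF i0] f(2)[OF i0]]]])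
  qed
  then have "f \<in> (\<Pi>\<^sub>E i\<in>I. level (S i) \<alpha>)"
    using f by (auto simp: PiE_iff level_def)
  then show "f \<in> (\<Union>\<alpha> :: 'a rel. \<Pi>\<^sub>E i\<in>I. level (S i) \<alpha>)" by blast
qed

section \<open>Normal trees of height \<open>\<omega>\<^sub>1\<close> and Souslin trees\<close>

text \<open>
  The normal, infinitely splitting c.c.c. trees of height \<open>\<omega>\<^sub>1\<close>. The axiom \<open>limit_unique\<close> covers level \<open>0\<close>
  as well, where it expresses that there is only one root.
\<close>

locale omega1_tree = level_tree T lv for T :: "'a rel" and lv +
  assumes nonempty: "Field T \<noteq> {}"
    and extend: "s \<in> Field T \<Longrightarrow> lv s \<le> \<beta> \<Longrightarrow> \<exists>t. (s, t) \<in> T \<and> lv t = \<beta>"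
    and limit_unique: "s \<in> Field T \<Longrightarrow> t \<in> Field T \<Longrightarrow> lv s = lv t \<Longrightarrow> (\<And>\<beta>. lv s \<noteq> osuc \<beta>) \<Longrightarrow>
      (\<And>\<beta>. \<beta> < lv s \<Longrightarrow> res s \<beta> = res t \<beta>) \<Longrightarrow> s = t"
    and infinite_succs: "s \<in> Field T \<Longrightarrow> infinite (succs s)"
    and ccc: "ccc T"
begin

lemma countable_level: "countable {t \<in> Field T. lv t = \<beta>}"
  using ccc antichain_level by (auto simp: ccc_def)

lemma countable_succs: "countable (succs s)"
  by (rule countable_subset[OF _ countable_level[of "osuc (lv s)"]])
    (auto simp: succs_def Field_def)

definition root :: 'a where
  "root = res (SOME t. t \<in> Field T) (LEAST \<beta>. True)"

lemma Least_ordinal: "(LEAST \<beta>. True) \<le> (\<gamma> :: countable_ordinal)"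
  by (rule Least_le) simp

lemma root_least: "t \<in> Field T \<Longrightarrow> (root, t) \<in> T"
proof -
  assume t: "t \<in> Field T"
  let ?u = "SOME t. t \<in> Field T" and ?z = "LEAST \<beta> :: countable_ordinal. True"
  have u: "?u \<in> Field T"
    using nonempty by (simp add: some_in_eq)
  note r = res[OF u Least_ordinal] and r' = res[OF t Least_ordinal]
  have "root = res t ?z"
    unfolding root_def
  proof (rule limit_unique[OF r(3) r'(3)])
    show "lv (res ?u ?z) = lv (res t ?z)"
      using r r' by simp
    have less: "\<not> \<beta> < lv (res ?u ?z)" for \<beta>
      unfolding r(2) using Least_ordinal not_less by blast
    then show "lv (res ?u ?z) \<noteq> osuc \<beta>" for \<beta>
      by (metis less_osuc)
    show "\<And>\<beta>. \<beta> < lv (res ?u ?z) \<Longrightarrow> res (res ?u ?z) \<beta> = res (res t ?z) \<beta>"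
      using less by blast
  qed
  then show ?thesis
    using r' by simp
qed

lemma root_Field: "root \<in> Field T"
  using root_least nonempty T_Field by blast

lemma lv_root: "lv root \<le> \<beta>"
proof -
  have "(SOME t. t \<in> Field T) \<in> Field T"
    using nonempty by (simp add: some_in_eq)
  from res(2)[OF this Least_ordinal] show ?thesis
    unfolding root_def using Least_ordinal by simp
qed

lemma level_nonempty: "\<exists>t\<in>Field T. lv t = \<beta>"
  using extend[OF root_Field lv_root[of \<beta>]] T_Field by blast

lemma has_height: "has_height T omega1"
  unfolding has_height_def
proof (intro conjI allI impI)
  show "Well_order omega1" by (rule Well_order_omega1)
  show "level T omega1 = {}"
  proof (rule ccontr)
    assume "level T omega1 \<noteq> {}"
    then obtain t where "t \<in> Field T" "ht T t =o omega1"
      by (auto simp: level_def)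
    then have "omega1 =o seg (lv t)"
      by (intro ordIso_transitive[OF ordIso_symmetric ht_ordIso_seg])
    then show False
      using not_ordLess_ordIso[OF seg_ordLess_omega1] ordIso_symmetric[of omega1] by blast
  qed
next
  fix \<alpha> :: "nat set rel" assume "\<alpha> <o omega1"
  then obtain \<beta> where "\<alpha> =o seg \<beta>" by (rule ordLess_omega1_seg)
  then have "level T \<alpha> = {t \<in> Field T. lv t = \<beta>}"
    using level_cong level_seg by blast
  then show "level T \<alpha> \<noteq> {}"
    using level_nonempty[of \<beta>] by blast
qed

lemma root_unique: "\<exists>!r. r \<in> Field T \<and> underS T r = {}"
proof (rule ex1I[of _ root])
  show "root \<in> Field T \<and> underS T root = {}"
    using root_Field lv_less[of _ root] lv_root not_less by (fastforce simp: underS_def)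
  show "r = root" if "r \<in> Field T \<and> underS T r = {}" for r
    using that root_least[of r] by (auto simp: underS_def)
qed

lemma normal_tree: "normal_tree omega1 T"
  unfolding normal_tree_def
proof (intro conjI ballI impI allI)
  show "tree T" by (rule tree)
  show "has_height T omega1" by (rule has_height)
  show "\<exists>!r. r \<in> Field T \<and> underS T r = {}" by (rule root_unique)
next
  fix s assume "s \<in> Field T"
  have inf: "infinite (succs s)"
    by (rule infinite_succs) fact
  then obtain t where t: "t \<in> succs s"
    by (metis all_not_in_conv finite.emptyI)
  have "infinite (succs s - {t})"
    using inf by simp
  then obtain u where "u \<in> succs s - {t}"
    by (metis all_not_in_conv finite.emptyI)
  with t show "\<exists>t\<in>immediate_successors T s. \<exists>u\<in>immediate_successors T s. t \<noteq> u"
    unfolding immediate_successors_eq by auto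
next
  fix s and \<alpha> :: "'a rel" assume s: "s \<in> Field T" and \<alpha>: "ht T s <o \<alpha> \<and> level T \<alpha> \<noteq> {}"
  then obtain u where u: "u \<in> level T \<alpha>" by blast
  then have uF: "u \<in> Field T" and "ht T u =o \<alpha>"
    by (auto simp: level_def)
  then have "ht T s <o ht T u"
    using ordLess_ordIso_trans[OF conjunct1[OF \<alpha>] ordIso_symmetric] by blast
  then have "lv s \<le> lv u"
    using ht_ordLess_iff[OF s uF] by simp
  then obtain t where "(s, t) \<in> T" "lv t = lv u"
    using extend[OF s] by blast
  then show "\<exists>t\<in>level T \<alpha>. (s, t) \<in> T"
    unfolding level_eq[OF u] using T_Field(2) by blast
next
  fix s t assume st: "s \<in> Field T" "t \<in> Field T"
    and *: "ht T s =o ht T t \<and> limit_ordinal (ht T s) \<and> underS T s = underS T t"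
  have lv: "lv s = lv t" "\<And>\<gamma>. lv s \<noteq> osuc \<gamma>"
    using * unfolding same_height_iff[OF st] limit_ordinal_ht[OF st(1)] by blast+
  show "s = t"
  proof (rule limit_unique[OF st lv])
    fix \<beta> assume \<beta>: "\<beta> < lv s"
    then have "(res s \<beta>, s) \<in> T" "lv (res s \<beta>) = \<beta>"
      using res[OF st(1)] by simp_all
    moreover from this have "res s \<beta> \<in> underS T s"
      using \<beta> by (auto simp: underS_def)
    then have "res s \<beta> \<in> underS T t"
      using * by simp
    then have "(res s \<beta>, t) \<in> T"
      by (simp add: underS_def)
    ultimately show "res s \<beta> = res t \<beta>"
      using res_eq[of "res s \<beta>" t] by simp
  qed
qed

lemma aleph0_splitting: "aleph0_splitting T"
  unfolding aleph0_splitting_def immediate_successors_eq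
proof (intro ballI impI)
  fix s assume "s \<in> Field T"
  then have "bij_betw (to_nat_on (succs s)) (succs s) UNIV"
    using to_nat_on_infinite countable_succs infinite_succs by blast
  then have "|succs s| =o |UNIV :: nat set|"
    by (rule card_of_ordIsoI)
  then show "|succs s| =o natLeq"
    by (rule ordIso_transitive[OF _ card_of_nat])
qed

text \<open>
  Choose for each node of the branch an immediate successor off the branch. The chosen nodes form an antichain,
  because a chosen node below another one would lie below a node of the branch, hence on the branch.
\<close>

lemma countable_branch:
  assumes "branch T B" shows "countable B"
proof -
  have chain: "(a, b) \<in> T \<or> (b, a) \<in> T" if "a \<in> B" "b \<in> B" for a b
    using assms that by (auto simp: branch_def Chains_def)
  have down: "a \<in> B" if "(a, b) \<in> T" "b \<in> B" for a b
    using assms that by (auto simp: branch_def under_def)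
  have BF: "B \<subseteq> Field T"
    using chain T_Field by blast
  have "\<exists>c. c \<in> succs b \<and> c \<notin> B" if b: "b \<in> B" for b
  proof (rule ccontr)
    assume "\<not> ?thesis"
    then have sub: "succs b \<subseteq> B" by blast
    have eq: "c = d" if "c \<in> succs b" "d \<in> succs b" for c d
      using chain[of c d] sub that same_lv_eq[of c d] same_lv_eq[of d c] by (auto simp: succs_def)
    have "infinite (succs b)"
      using infinite_succs BF b by blast
    then obtain c where "c \<in> succs b"
      by (metis all_not_in_conv finite.emptyI)
    then have "succs b \<subseteq> {c}"
      using eq by blast
    then show False
      using \<open>infinite (succs b)\<close> finite_subset by blast
  qed
  then obtain c where c: "\<And>b. b \<in> B \<Longrightarrow> c b \<in> succs b \<and> c b \<notin> B"
    by metis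
  have eq: "b = b'" if b: "b \<in> B" "b' \<in> B" and le: "(c b, c b') \<in> T" for b b'
  proof (rule ccontr)
    assume "b \<noteq> b'"
    have sb: "(b, c b) \<in> T" "lv (c b) = osuc (lv b)" "(b', c b') \<in> T" "lv (c b') = osuc (lv b')"
      using c[OF b(1)] c[OF b(2)] by (auto simp: succs_def)
    consider "lv b < lv b'" | "lv b' < lv b"
      using chain[OF b] lv_less \<open>b \<noteq> b'\<close> by blast
    then show False
    proof cases
      case 1
      then have "(c b, b') \<in> T"
        using linear_below[OF le sb(3)] sb(2) by simp
      then show False
        using down b c by blast
    next
      case 2
      then show False
        using lv_le[OF le] sb by (simp add: not_less[symmetric])
    qed
  qed
  have Tcc: "(c b, c b) \<in> T" if "b \<in> B" for b
    using c[OF that] T_refl T_Field by (auto simp: succs_def)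
  then have "inj_on c B"
    using eq by (intro inj_onI) metis
  moreover have "antichain T (c ` B)"
    unfolding antichain_def
  proof (intro conjI ballI impI)
    show "c ` B \<subseteq> Field T"
      using Tcc T_Field(1) by blast
  qed (use eq in blast)+
  then have "countable (c ` B)"
    using ccc by (auto simp: ccc_def)
  ultimately show ?thesis
    using countable_image_inj_on by blast
qed

lemma Souslin_tree: "Souslin_tree T"
  unfolding Souslin_tree_def
  using normal_tree aleph0_splitting ccc countable_branch by blast

end

text \<open>
  Normality speaks of levels given by well-orders on the node type. Every level has such a
  representative, namely the height of one of its nodes, so levels may be replaced by values of \<open>lv\<close>.
\<close>

lemma Souslin_tree_imp_omega1_tree:
  fixes T :: "'a rel"
  assumes "Souslin_tree T"
  obtains lv where "omega1_tree T lv"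
proof -
  have normal: "normal_tree omega1 T" and split: "aleph0_splitting T" and "ccc T"
    using assms unfolding Souslin_tree_def by blast+
  note N = normal[unfolded normal_tree_def]
  have tree: "tree T" and height: "has_height T omega1"
    by (rule N[THEN conjunct1] N[THEN conjunct2, THEN conjunct1])+
  note N = N[THEN conjunct2, THEN conjunct2]
  have root: "\<exists>!r. r \<in> Field T \<and> underS T r = {}"
    by (rule N[THEN conjunct1])
  note N = N[THEN conjunct2, THEN conjunct2]
  have ext: "\<exists>t\<in>level T \<alpha>. (s, t) \<in> T"
    if "s \<in> Field T" "ht T s <o \<alpha>" "level T \<alpha> \<noteq> {}" for s and \<alpha> :: "'a rel"
    by (rule N[THEN conjunct1, rule_format, OF that(1) conjI[OF that(2,3)]])
  have uniq: "s = t" if "s \<in> Field T" "t \<in> Field T" "ht T s =o ht T t"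
      "limit_ordinal (ht T s)" "underS T s = underS T t" for s t
    by (rule N[THEN conjunct2, rule_format, OF that(1,2) conjI[OF that(3) conjI[OF that(4,5)]]])
  obtain lv where "level_tree T lv"
    using level_tree_exists[OF tree height] .
  then interpret level_tree T lv .
  have extend: "\<exists>t. (s, t) \<in> T \<and> lv t = \<beta>" if s: "s \<in> Field T" and \<beta>: "lv s \<le> \<beta>" for s \<beta>
  proof (cases "lv s = \<beta>")
    case True
    then show ?thesis using T_refl[OF s] by blast
  next
    case False
    obtain a where a: "seg \<beta> =o Restr omega1 (underS omega1 a)" "a \<in> Field omega1"
      using ordLess_iff_ordIso_Restr[OF Well_order_omega1 Well_order_seg] seg_ordLess_omega1 by blast
    have "level T (Restr omega1 (underS omega1 a)) \<noteq> {}"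
      using height underS_Restr_ordLess[OF Well_order_omega1 infinite_imp_nonempty[OF infinite_Field_omega1]]
      unfolding has_height_def by blast
    then have "level T (seg \<beta>) \<noteq> {}"
      using level_cong[OF a(1)] by simp
    then obtain u where u: "u \<in> Field T" "lv u = \<beta>"
      unfolding level_seg by blast
    have "ht T s <o ht T u"
      using ht_ordLess_iff[OF s u(1)] u(2) \<beta> False by simp
    moreover have ul: "u \<in> level T (ht T u)"
      using u(1) ordIso_transitive[OF ht_ordIso_seg ordIso_symmetric[OF ht_ordIso_seg]]
      by (auto simp: level_def)
    ultimately obtain t where "t \<in> level T (ht T u)" "(s, t) \<in> T"
      using ext[OF s] by blast
    then show ?thesis
      using level_eq[OF ul] u(2) by blast
  qed
  have "omega1_tree T lv"
  proof
    show "Field T \<noteq> {}" using root by blast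
    show "ccc T" by fact
    show "\<exists>t. (s, t) \<in> T \<and> lv t = \<beta>" if "s \<in> Field T" "lv s \<le> \<beta>" for s \<beta>
      by (rule extend[OF that])
  next
    fix s assume s: "s \<in> Field T"
    obtain t where "(s, t) \<in> T" "lv t = osuc (lv s)"
      using extend[OF s] less_osuc less_imp_le by blast
    then have "t \<in> aboveS T s"
      by (auto simp: aboveS_def)
    then have "|succs s| =o natLeq"
      using split s unfolding aleph0_splitting_def immediate_successors_eq by blast
    then have "|succs s| =o |UNIV :: nat set|"
      by (rule ordIso_transitive[OF _ ordIso_symmetric[OF card_of_nat]])
    then show "infinite (succs s)"
      using card_of_ordIso_finite infinite_UNIV_nat by blast
  next
    fix s t assume st: "s \<in> Field T" "t \<in> Field T" and lv: "lv s = lv t" "\<And>\<beta>. lv s \<noteq> osuc \<beta>"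
      and below: "\<And>\<beta>. \<beta> < lv s \<Longrightarrow> res s \<beta> = res t \<beta>"
    have sub: "underS T s \<subseteq> underS T t" if "lv s = lv t" "s \<in> Field T" "t \<in> Field T"
      "\<And>\<beta>. \<beta> < lv s \<Longrightarrow> res s \<beta> = res t \<beta>" for s t
    proof
      fix u assume "u \<in> underS T s"
      then have u: "(u, s) \<in> T" "lv u < lv s"
        using lv_less by (auto simp: underS_def)
      then have "u = res t (lv u)"
        using res_eq that(4) by metis
      then have "(u, t) \<in> T"
        using res(1)[OF that(3), of "lv u"] u(2) that(1) by simp
      then show "u \<in> underS T t"
        using u(2) that(1) by (auto simp: underS_def)
    qed
    have eq: "underS T s = underS T t"
      using sub[of s t] sub[of t s] lv(1) st below by auto
    show "s = t"
    proof (cases "\<exists>\<gamma>. \<gamma> < lv s")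
      case True
      show ?thesis
        by (rule uniq[OF st _ _ eq])
          (use same_height_iff[OF st] limit_ordinal_ht[OF st(1)] lv True in blast)+
    next
      case False
      then have "underS T s = {}"
        using lv_less by (auto simp: underS_def)
      then show ?thesis
        using root eq st by metis
    qed
  qed
  then show ?thesis by (rule that)
qed

section \<open>Homogeneous trees\<close>

text \<open>
  A coherent family in terms of levels. In \<open>psi_limit\<close> the assumption \<open>\<gamma> < lv t\<close> excludes level \<open>0\<close>.
\<close>

locale homogeneous_tree = omega1_tree T lv for T :: "'a rel" and lv +
  fixes \<psi> :: "'a \<Rightarrow> 'a \<Rightarrow> 'a \<Rightarrow> 'a"
  assumes psi_bij: "s \<in> Field T \<Longrightarrow> t \<in> Field T \<Longrightarrow> lv s = lv t \<Longrightarrow>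
      bij_betw (\<psi> s t) (above T s) (above T t)"
    and psi_le_iff: "s \<in> Field T \<Longrightarrow> t \<in> Field T \<Longrightarrow> lv s = lv t \<Longrightarrow> (s, x) \<in> T \<Longrightarrow> (s, y) \<in> T \<Longrightarrow>
      (\<psi> s t x, \<psi> s t y) \<in> T \<longleftrightarrow> (x, y) \<in> T"
    and psi_id: "(s, x) \<in> T \<Longrightarrow> \<psi> s s x = x"
    and psi_comp: "r \<in> Field T \<Longrightarrow> s \<in> Field T \<Longrightarrow> t \<in> Field T \<Longrightarrow> lv r = lv s \<Longrightarrow> lv s = lv t \<Longrightarrow>
      (r, x) \<in> T \<Longrightarrow> \<psi> s t (\<psi> r s x) = \<psi> r t x"
    and psi_restrict: "r \<in> Field T \<Longrightarrow> s \<in> Field T \<Longrightarrow> lv r = lv s \<Longrightarrow> (r, t) \<in> T \<Longrightarrow> (t, x) \<in> T \<Longrightarrow>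
      \<psi> t (\<psi> r s t) x = \<psi> r s x"
    and psi_limit: "t \<in> Field T \<Longrightarrow> u \<in> Field T \<Longrightarrow> lv t = lv u \<Longrightarrow> \<gamma> < lv t \<Longrightarrow>
      (\<And>\<beta>. lv t \<noteq> osuc \<beta>) \<Longrightarrow> \<exists>\<delta><lv t. \<psi> (res t \<delta>) (res u \<delta>) t = u"
begin

lemma psi_above: "s \<in> Field T \<Longrightarrow> t \<in> Field T \<Longrightarrow> lv s = lv t \<Longrightarrow> (s, x) \<in> T \<Longrightarrow> (t, \<psi> s t x) \<in> T"
  using bij_betwE[OF psi_bij[of s t]] by (auto simp: above_def)

lemma psi_onto: "s \<in> Field T \<Longrightarrow> t \<in> Field T \<Longrightarrow> lv s = lv t \<Longrightarrow> (t, y) \<in> T \<Longrightarrow>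
    \<exists>x. (s, x) \<in> T \<and> \<psi> s t x = y"
proof -
  assume st: "s \<in> Field T" "t \<in> Field T" "lv s = lv t" and "(t, y) \<in> T"
  then have "y \<in> \<psi> s t ` above T s"
    using bij_betw_imp_surj_on[OF psi_bij[OF st]] by (simp add: above_def)
  then show ?thesis
    by (auto simp: above_def)
qed

lemma psi_inject: "s \<in> Field T \<Longrightarrow> t \<in> Field T \<Longrightarrow> lv s = lv t \<Longrightarrow> (s, x) \<in> T \<Longrightarrow> (s, y) \<in> T \<Longrightarrow>
    \<psi> s t x = \<psi> s t y \<longleftrightarrow> x = y"
  using bij_betw_imp_inj_on[OF psi_bij[of s t]] by (auto simp: above_def inj_on_def)

text \<open>
  An isomorphism between the trees above two nodes of the same level preserves the distance to the
  bottom node, hence the level.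
\<close>

lemma psi_lv:
  assumes st: "s \<in> Field T" "t \<in> Field T" "lv s = lv t" and "(s, x) \<in> T"
  shows "lv (\<psi> s t x) = lv x"
  using assms(4)
proof (induction "lv x" arbitrary: x rule: less_induct)
  case (less x)
  define y where "y = \<psi> s t x"
  have ty: "(t, y) \<in> T"
    unfolding y_def by (rule psi_above[OF st less.prems])
  note F = T_Field(2)[OF less.prems] T_Field(2)[OF ty]
  show ?case
  proof (cases "lv x" "lv y" rule: linorder_cases)
    case 1: less
    define y' where "y' = res y (lv x)"
    have y': "(t, y') \<in> T" "(y', y) \<in> T" "lv y' = lv x"
      using res_le[OF ty] res[OF F(2)] 1 lv_le[OF less.prems] st(3) unfolding y'_def by auto
    obtain x' where x': "(s, x') \<in> T" "\<psi> s t x' = y'"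
      using psi_onto[OF st y'(1)] by blast
    have "(x', x) \<in> T"
      using psi_le_iff[OF st x'(1) less.prems] x'(2) y'(2) y_def by simp
    moreover have "x' \<noteq> x"
      using 1 x' y' y_def by auto
    ultimately have "lv x' < lv x"
      by (rule lv_less)
    with less.hyps[OF this x'(1)] x' y' show ?thesis by simp
  next
    case equal
    then show ?thesis by (simp add: y_def)
  next
    case 3: greater
    define x' where "x' = res x (lv y)"
    have x': "(s, x') \<in> T" "(x', x) \<in> T" "lv x' = lv y"
      using res_le[OF less.prems] res[OF F(1)] 3 lv_le[OF ty] st(3) unfolding x'_def by auto
    have "(\<psi> s t x', y) \<in> T"
      using psi_le_iff[OF st x'(1) less.prems] x'(2) y_def by simp
    moreover have "lv (\<psi> s t x') = lv y"
      using less.hyps[OF _ x'(1)] 3 x'(3) by simp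
    ultimately have "\<psi> s t x' = \<psi> s t x"
      using same_lv_eq y_def by simp
    then have "x' = x"
      using psi_inject[OF st x'(1) less.prems] by simp
    then show ?thesis
      using x' 3 by simp
  qed
qed

lemma psi_Field: "s \<in> Field T \<Longrightarrow> t \<in> Field T \<Longrightarrow> lv s = lv t \<Longrightarrow> (s, x) \<in> T \<Longrightarrow> \<psi> s t x \<in> Field T"
  using psi_above T_Field by blast

lemma psi_base:
  assumes st: "s \<in> Field T" "t \<in> Field T" "lv s = lv t"
  shows "\<psi> s t s = t"
proof -
  have s: "(s, s) \<in> T" by (rule T_refl[OF st(1)])
  have "lv t = lv (\<psi> s t s)"
    unfolding psi_lv[OF st s] by (rule st(3)[symmetric])
  from same_lv_eq[OF psi_above[OF st s] this] show ?thesis by (rule sym)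
qed

lemma psi_res:
  assumes st: "s \<in> Field T" "t \<in> Field T" "lv s = lv t" and x: "(s, x) \<in> T"
    and \<beta>: "lv s \<le> \<beta>" "\<beta> \<le> lv x"
  shows "res (\<psi> s t x) \<beta> = \<psi> s t (res x \<beta>)"
proof -
  have r: "(s, res x \<beta>) \<in> T" "(res x \<beta>, x) \<in> T" "lv (res x \<beta>) = \<beta>"
    using res_le[OF x \<beta>] res[OF T_Field(2)[OF x] \<beta>(2)] by auto
  then have "(\<psi> s t (res x \<beta>), \<psi> s t x) \<in> T"
    using psi_le_iff[OF st r(1) x] by simp
  then show ?thesis
    using res_eq[of "\<psi> s t (res x \<beta>)" "\<psi> s t x"] psi_lv[OF st r(1)] r(3) by simp
qed

lemma psi_succs:
  assumes "s \<in> Field T" "t \<in> Field T" "lv s = lv t" "x \<in> succs s"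
  shows "\<psi> s t x \<in> succs t"
  using assms psi_above psi_lv by (simp add: succs_def)

text \<open>
  By the restriction property a coherence witness can be raised to any higher level up to
  that of the nodes; hence finitely many nodes of a limit level have a common witness.
\<close>

lemma psi_raise:
  assumes tu: "t \<in> Field T" "u \<in> Field T" "lv t = lv u"
    and "\<delta> \<le> \<delta>'" "\<delta>' \<le> lv t" and eq: "\<psi> (res t \<delta>) (res u \<delta>) t = u"
  shows "\<psi> (res t \<delta>') (res u \<delta>') t = u"
proof -
  have \<delta>: "\<delta> \<le> lv t" "\<delta> \<le> lv u" "\<delta>' \<le> lv u"
    using assms by auto
  note r = res[OF tu(1) \<delta>(1)] and r' = res[OF tu(2) \<delta>(2)]
  have lv: "lv (res t \<delta>) = lv (res u \<delta>)"
    using r r' by simp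
  have le: "(res t \<delta>, res t \<delta>') \<in> T" "(res t \<delta>', t) \<in> T"
    using res_mono[OF tu(1)] res(1)[OF tu(1)] assms by auto
  have "res u \<delta>' = \<psi> (res t \<delta>) (res u \<delta>) (res t \<delta>')"
    using psi_res[OF r(3) r'(3) lv r(1), of \<delta>'] assms(4,5) eq r(2) by simp
  then show ?thesis
    using psi_restrict[OF r(3) r'(3) lv le] eq by simp
qed

lemma psi_limit_finite:
  assumes "finite A" "t \<in> Field T" "A \<subseteq> {u \<in> Field T. lv u = lv t}" "\<gamma> < lv t" "\<And>\<beta>. lv t \<noteq> osuc \<beta>"
  shows "\<exists>\<delta><lv t. \<gamma> \<le> \<delta> \<and> (\<forall>u\<in>A. \<psi> (res t \<delta>) (res u \<delta>) t = u)"
  using assms(1,3)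
proof (induction A)
  case empty
  then show ?case using assms(4) by blast
next
  case (insert u A)
  then obtain \<delta> where \<delta>: "\<delta> < lv t" "\<gamma> \<le> \<delta>" "\<forall>u\<in>A. \<psi> (res t \<delta>) (res u \<delta>) t = u"
    by auto
  have u: "u \<in> Field T" "lv t = lv u"
    using insert by auto
  obtain \<delta>' where \<delta>': "\<delta>' < lv t" "\<psi> (res t \<delta>') (res u \<delta>') t = u"
    using psi_limit[OF assms(2) u assms(4,5)] by blast
  let ?\<delta> = "max \<delta> \<delta>'"
  have max: "?\<delta> < lv t" "\<gamma> \<le> ?\<delta>"
    using \<delta> \<delta>' by (auto simp: max_def)
  have le: "\<delta> \<le> ?\<delta>" "\<delta>' \<le> ?\<delta>" "?\<delta> \<le> lv t"
    using less_imp_le[OF max(1)] by simp_all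
  have "\<psi> (res t ?\<delta>) (res u' ?\<delta>) t = u'" if "u' \<in> insert u A" for u'
  proof (cases "u' = u")
    case True
    then show ?thesis
      using psi_raise[OF assms(2) u le(2,3) \<delta>'(2)] by simp
  next
    case False
    then have "u' \<in> Field T" "lv t = lv u'" "\<psi> (res t \<delta>) (res u' \<delta>) t = u'"
      using that insert.prems \<delta>(3) by auto
    then show ?thesis
      using psi_raise[OF assms(2) _ _ le(1,3)] by blast
  qed
  then show ?case using max by blast
qed

end

text \<open>
  The witnesses of the limit condition are given as predecessors on some level, so they are restrictions.
\<close>

lemma (in omega1_tree) homogeneous_tree_coherent:
  assumes "coherent_family T \<psi>"
  shows "homogeneous_tree T lv \<psi>"
proof -
  note C = assms[unfolded coherent_family_def]
  have iso: "tree_iso (\<psi> s t) (subtree T s) (subtree T t)"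
    if "s \<in> Field T" "t \<in> Field T" "lv s = lv t" for s t
    using C[THEN conjunct1] that same_height_iff by blast
  note C2 = C[THEN conjunct2, THEN conjunct1] and C3 = C[THEN conjunct2, THEN conjunct2, THEN conjunct1]
  note C' = C[THEN conjunct2, THEN conjunct2, THEN conjunct2]
  note C4 = C'[THEN conjunct1] and C5 = C'[THEN conjunct2]
  show ?thesis
  proof
    show "bij_betw (\<psi> s t) (above T s) (above T t)" if "s \<in> Field T" "t \<in> Field T" "lv s = lv t" for s t
      using iso[OF that] Field_subtree that by (simp add: tree_iso_def)
    show "(\<psi> s t x, \<psi> s t y) \<in> T \<longleftrightarrow> (x, y) \<in> T"
      if st: "s \<in> Field T" "t \<in> Field T" "lv s = lv t" and xy: "(s, x) \<in> T" "(s, y) \<in> T" for s t x y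
    proof -
      have i: "bij_betw (\<psi> s t) (above T s) (above T t)"
          "(x, y) \<in> subtree T s \<longleftrightarrow> (\<psi> s t x, \<psi> s t y) \<in> subtree T t"
        using iso[OF st] xy Field_subtree st by (simp_all add: tree_iso_def above_def)
      have "\<psi> s t x \<in> above T t" "\<psi> s t y \<in> above T t"
        using bij_betwE[OF i(1)] xy by (auto simp: above_def)
      then show ?thesis
        using i(2) xy by (simp add: subtree_def above_def)
    qed
    show "\<psi> s s x = x" if "(s, x) \<in> T" for s x
      using C2 that T_Field by (auto simp: above_def)
    show "\<psi> s t (\<psi> r s x) = \<psi> r t x"
      if "r \<in> Field T" "s \<in> Field T" "t \<in> Field T" "lv r = lv s" "lv s = lv t" "(r, x) \<in> T" for r s t x
    proof -
      have "\<forall>x\<in>above T r. \<psi> r t x = \<psi> s t (\<psi> r s x)"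
        using that same_height_iff by (intro C3[THEN spec, THEN spec, THEN spec, THEN mp]) simp
      then show ?thesis using that(6) by (simp add: above_def)
    qed
    show "\<psi> t (\<psi> r s t) x = \<psi> r s x"
      if "r \<in> Field T" "s \<in> Field T" "lv r = lv s" "(r, t) \<in> T" "(t, x) \<in> T" for r s t x
    proof -
      have "\<forall>t\<in>above T r. \<forall>x\<in>above T t. \<psi> t (\<psi> r s t) x = \<psi> r s x"
        using that same_height_iff by (intro C4[THEN spec, THEN spec, THEN mp]) simp
      then show ?thesis using that(4,5) by (simp add: above_def)
    qed
    show "\<exists>\<delta><lv t. \<psi> (res t \<delta>) (res u \<delta>) t = u"
      if tu: "t \<in> Field T" "u \<in> Field T" "lv t = lv u" and "\<gamma> < lv t" "\<And>\<beta>. lv t \<noteq> osuc \<beta>" for t u \<gamma>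
    proof -
      have "limit_ordinal (ht T t)"
        using limit_ordinal_ht[OF tu(1)] that(4,5) by blast
      then obtain \<alpha> :: "'a rel" and r s where "r \<in> underS T t \<inter> level T \<alpha>" "s \<in> underS T u \<inter> level T \<alpha>"
          "\<psi> r s t = u"
        using C5[rule_format, OF conjI[OF conjI[OF tu(1) conjI[OF tu(2)]]]] same_height_iff[OF tu(1,2)] tu(3) by blast
      then have rs: "(r, t) \<in> T" "r \<noteq> t" "(s, u) \<in> T" "lv s = lv r" "\<psi> r s t = u"
        using level_eq[of r \<alpha>] by (auto simp: underS_def)
      then have "res t (lv r) = r" "res u (lv r) = s"
        using res_eq[OF rs(1)] res_eq[OF rs(3)] by simp_all
      then show ?thesis
        using lv_less[OF rs(1,2)] rs(5) by auto
    qed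
  qed
qed

section \<open>Independent colourings\<close>

text \<open>
  The combinatorial core. Think of \<open>col k\<close> as the \<open>k\<close>-th column of a table with rows \<open>(m, w)\<close>, where the
  column stands for a successor, \<open>w\<close> for an \<open>m\<close>-equivalence class and the entry for a colour. The first
  property forces a column to be determined by its entries in any \<open>n\<close> rows \<open>(0, w\<^sub>0), \<dots>, (n - 1, w\<^sub>n\<^sub>-\<^sub>1)\<close>; the
  second one provides columns with prescribed entries, in rows with different first components and in
  rows with the same first component.

  The columns are constructed one after another. The \<open>k\<close>-th one meets the \<open>k\<close>-th requirement, a finite
  partial column, unless an earlier column meets it; all other entries are fresh. An entirely fresh column
  is separated from the earlier ones. Otherwise an earlier column violates the requirement in some row
  \<open>(m, w)\<close>. If the first components in the requirement are different, then no other row of block \<open>m\<close> is prescribed, so the two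
  columns differ in the entire block. If they are all the same, then any other block is entirely fresh,
  and there is another one since \<open>n \<ge> 2\<close>.
\<close>

lemma independent_columns:
  assumes n: "(2 :: nat) \<le> n"
  obtains col :: "nat \<Rightarrow> nat \<times> nat \<Rightarrow> nat" where
    "\<And>j k. j \<noteq> k \<Longrightarrow> \<exists>m<n. \<forall>w. col j (m, w) \<noteq> col k (m, w)"
    "\<And>I v. finite I \<Longrightarrow> fst ` I \<subseteq> {..<n} \<Longrightarrow>
       inj_on fst I \<or> (\<forall>p\<in>I. \<forall>p'\<in>I. fst p = fst p') \<Longrightarrow> \<exists>k. \<forall>p\<in>I. col k p = v p"
proof -
  define task where "task k = map_of (from_nat k :: ((nat \<times> nat) \<times> nat) list)" for k
  define meets where "meets c k \<longleftrightarrow> (\<forall>p\<in>dom (task k). task k p = Some (c p))" for c k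
  define sep where "sep c d \<longleftrightarrow> (\<exists>m<n. \<forall>w. c (m, w) \<noteq> d (m, w))" for c d :: "nat \<times> nat \<Rightarrow> nat"
  define ok where "ok I \<longleftrightarrow> fst ` I \<subseteq> {..<n} \<and> (inj_on fst I \<or> (\<forall>p\<in>I. \<forall>p'\<in>I. fst p = fst p'))"
    for I :: "(nat \<times> nat) set"
  define P where "P f k c \<longleftrightarrow> (\<forall>j<k. sep (f j) c) \<and> (ok (dom (task k)) \<longrightarrow> (\<exists>j<k. meets (f j) k) \<or> meets c k)"
    for f k c
  have "\<exists>f. \<forall>k. P f k (f k)"
  proof (rule dependent_wf_choice[OF wf_less_than])
    show "P f k c = P g k c" if "\<And>z. (z, k) \<in> less_than \<Longrightarrow> f z = g z" for f g k c
      using that by (auto simp: P_def)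
  next
    fix k and f :: "nat \<Rightarrow> nat \<times> nat \<Rightarrow> nat"
    \<comment> \<open>Exceeds the entries of all earlier columns in row \<open>p\<close>.\<close>
    define fresh where "fresh p = Suc (\<Sum>j<k. f j p)" for p
    have fresh: "f j p \<noteq> fresh p" if "j < k" for j p
      using member_le_sum[of j "{..<k}" "\<lambda>j. f j p"] that by (auto simp: fresh_def)
    show "\<exists>c. P f k c"
    proof (cases "ok (dom (task k)) \<and> (\<forall>j<k. \<not> meets (f j) k)")
      case False
      then have "P f k fresh"
        unfolding P_def sep_def using fresh n by (auto intro!: exI[of _ 0])
      then show ?thesis by blast
    next
      case True
      define c where "c p = (case task k p of Some v \<Rightarrow> v | None \<Rightarrow> fresh p)" for p
      have "sep (f j) c" if j: "j < k" for j
      proof -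
        have outside: "f j p \<noteq> c p" if "p \<notin> dom (task k)" for p
          using that fresh[OF j] by (auto simp: c_def dom_def)
        obtain p where p: "p \<in> dom (task k)" "task k p \<noteq> Some (f j p)"
          using True j unfolding meets_def by blast
        then have ne: "f j p \<noteq> c p"
          by (auto simp: c_def split: option.split)
        have "fst p < n"
          using True p(1) unfolding ok_def by blast
        show ?thesis
        proof (cases "inj_on fst (dom (task k))")
          case True
          have "f j (fst p, w) \<noteq> c (fst p, w)" for w
          proof (cases "(fst p, w) \<in> dom (task k)")
            case in_dom: True
            have "(fst p, w) = p"
              using inj_onD[OF True _ in_dom p(1)] by simp
            then show ?thesis using ne by simp
          qed (rule outside)
          then show ?thesis
            using \<open>fst p < n\<close> by (auto simp: sep_def)
        next
          case False
          then have const: "fst p' = fst p" if "p' \<in> dom (task k)" for p'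
            using True p(1) that unfolding ok_def by blast
          obtain m where m: "m < n" "m \<noteq> fst p"
            using n by (cases "fst p = 0") (auto intro: that[of 0] that[of 1])
          then have "f j (m, w) \<noteq> c (m, w)" for w
            using const[of "(m, w)"] by (intro outside) auto
          then show ?thesis
            using m by (auto simp: sep_def)
        qed
      qed
      moreover have "meets c k"
        by (auto simp: meets_def c_def)
      ultimately have "P f k c"
        by (simp add: P_def)
      then show ?thesis by blast
    qed
  qed
  then obtain col where col: "\<And>k. P col k (col k)" by blast
  show ?thesis
  proof (rule that[of col])
    fix j k :: nat assume "j \<noteq> k"
    then consider "j < k" | "k < j" by linarith
    then show "\<exists>m<n. \<forall>w. col j (m, w) \<noteq> col k (m, w)"
    proof cases
      case 1
      then show ?thesis using col[of k] by (auto simp: P_def sep_def)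
    next
      case 2
      then have "sep (col k) (col j)" using col[of j] by (auto simp: P_def)
      then show ?thesis unfolding sep_def by metis
    qed
  next
    fix I :: "(nat \<times> nat) set" and v :: "nat \<times> nat \<Rightarrow> nat"
    assume fin: "finite I" and I: "fst ` I \<subseteq> {..<n}" "inj_on fst I \<or> (\<forall>p\<in>I. \<forall>p'\<in>I. fst p = fst p')"
    obtain xs where xs: "set xs = I"
      using finite_list[OF fin] by blast
    \<comment> \<open>A total assignment on \<open>I\<close> is one of the listed requirements.\<close>
    define k where "k = to_nat (map (\<lambda>p. (p, v p)) xs)"
    have task: "task k = (Some \<circ> v) |` I"
      by (simp add: task_def k_def map_of_map_restrict xs)
    then have dom: "dom (task k) = I"
      by (auto simp: restrict_map_def split: if_splits)
    have "ok (dom (task k))"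
      using I dom by (simp add: ok_def)
    then obtain j where "meets (col j) k"
      using col[of k] by (auto simp: P_def)
    then have "\<forall>p\<in>I. col j p = v p"
      unfolding meets_def dom by (simp add: task)
    then show "\<exists>k. \<forall>p\<in>I. col k p = v p" by blast
  qed
qed

text \<open>
  The two kinds of families for which independence is required. The first kind (different indices)
  serves surjectivity onto the product, the second one (one index, inequivalent nodes) freeness.
\<close>

definition admissible :: "(nat \<Rightarrow> 'a \<Rightarrow> 'a \<Rightarrow> bool) \<Rightarrow> (nat \<times> 'a) set \<Rightarrow> bool" where
  "admissible E I \<longleftrightarrow> inj_on fst I \<or>
     (\<forall>p\<in>I. \<forall>p'\<in>I. p \<noteq> p' \<longrightarrow> fst p = fst p' \<and> \<not> E (fst p) (snd p) (snd p'))"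

context homogeneous_tree begin

text \<open>
  The colour \<open>c \<gamma> m t\<close> belongs to the nodes \<open>t\<close> on level \<open>osuc \<gamma>\<close>. With this indexing, equivalence on level \<open>\<beta>\<close>
  depends on \<open>c \<gamma>\<close> for \<open>\<gamma> < \<beta>\<close> only, as the recursion in \<open>good_colourings_exist\<close> requires.
\<close>

definition col_equiv ::
  "(countable_ordinal \<Rightarrow> nat \<Rightarrow> 'a \<Rightarrow> nat) \<Rightarrow> nat \<Rightarrow> 'a \<Rightarrow> 'a \<Rightarrow> bool" where
  "col_equiv c m s t \<longleftrightarrow> s \<in> Field T \<and> t \<in> Field T \<and> lv s = lv t \<and>
     (\<forall>\<gamma><lv s. c \<gamma> m (res s (osuc \<gamma>)) = c \<gamma> m (res t (osuc \<gamma>)))"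

text \<open>
  The first clause makes the colouring a colouring of the quotient by equivalence. The second one is the
  successor step of the lifting lemma. The third one makes the map into the product injective.
\<close>

definition good_colouring ::
  "nat \<Rightarrow> (nat \<Rightarrow> 'a \<Rightarrow> 'a \<Rightarrow> bool) \<Rightarrow> countable_ordinal \<Rightarrow> (nat \<Rightarrow> 'a \<Rightarrow> nat) \<Rightarrow> bool" where
  "good_colouring n E \<beta> c \<longleftrightarrow>
     (\<forall>m s s' t. lv s = \<beta> \<and> E m s s' \<and> t \<in> succs s \<longrightarrow> c m (\<psi> s s' t) = c m t) \<and>
     (\<forall>q I v. q \<in> Field T \<and> lv q = \<beta> \<and> finite I \<and> I \<subseteq> {..<n} \<times> {s \<in> Field T. lv s = \<beta>} \<and>
        admissible E I \<longrightarrow> (\<exists>z\<in>succs q. \<forall>p\<in>I. c (fst p) (\<psi> q (snd p) z) = v p)) \<and>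
     (\<forall>s t t'. s \<in> Field T \<and> lv s = \<beta> \<and> t \<in> succs s \<and> t' \<in> succs s \<and> t \<noteq> t' \<longrightarrow>
        (\<exists>m<n. c m t \<noteq> c m t'))"

text \<open>
  Identify the successors of all nodes on level \<open>\<beta>\<close> with those of one node \<open>q0\<close>, enumerate these and let
  the enumeration choose the column of \<open>independent_columns\<close>; the class of \<open>s\<close> chooses the row.
\<close>

lemma good_colouring_exists:
  assumes n: "2 \<le> n"
    and E_level: "\<And>m s t. E m s t \<Longrightarrow> t \<in> Field T \<and> lv t = \<beta>"
    and E_refl: "\<And>m s. s \<in> Field T \<Longrightarrow> lv s = \<beta> \<Longrightarrow> E m s s"
    and E_sym: "\<And>m s t. E m s t \<Longrightarrow> E m t s"
    and E_trans: "\<And>m s t u. E m s t \<Longrightarrow> E m t u \<Longrightarrow> E m s u"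
  shows "\<exists>c. good_colouring n E \<beta> c"
proof -
  obtain col :: "nat \<Rightarrow> nat \<times> nat \<Rightarrow> nat" where
    sep: "\<And>j k. j \<noteq> k \<Longrightarrow> \<exists>m<n. \<forall>w. col j (m, w) \<noteq> col k (m, w)" and
    hit: "\<And>I v. finite I \<Longrightarrow> fst ` I \<subseteq> {..<n} \<Longrightarrow>
       inj_on fst I \<or> (\<forall>p\<in>I. \<forall>p'\<in>I. fst p = fst p') \<Longrightarrow> \<exists>k. \<forall>p\<in>I. col k p = v p"
    using independent_columns[OF n] by blast
  define L where "L = {s \<in> Field T. lv s = \<beta>}"
  have LD: "s \<in> Field T" "lv s = \<beta>" if "s \<in> L" for s
    using that by (auto simp: L_def)
  have E_L: "s \<in> L" "t \<in> L" if "E m s t" for m s t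
    using E_level that E_sym[OF that] by (auto simp: L_def)
  obtain q0 where q0: "q0 \<in> L"
    using level_nonempty[of \<beta>] by (auto simp: L_def)
  define en where "en = to_nat_on (succs q0)"
  have en: "bij_betw en (succs q0) UNIV"
    unfolding en_def
    by (rule to_nat_on_infinite[OF countable_succs infinite_succs]) (rule LD[OF q0])
  \<comment> \<open>Number of the \<open>m\<close>-equivalence class of \<open>s\<close>.\<close>
  define code where "code m s = to_nat_on L (SOME x. E m s x)" for m s
  have code_eq: "code m s = code m t \<longleftrightarrow> E m s t" if "s \<in> L" "t \<in> L" for m s t
  proof
    have ex: "E m u (SOME x. E m u x)" if "u \<in> L" for u
      using someI[of "E m u" u] E_refl LD that by blast
    assume "code m s = code m t"
    then have "(SOME x. E m s x) = (SOME x. E m t x)"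
      using inj_on_to_nat_on[of L] countable_level[of \<beta>] E_L(2)[OF ex[OF that(1)]] E_L(2)[OF ex[OF that(2)]]
      unfolding code_def inj_on_def L_def by blast
    then show "E m s t"
      using ex[OF that(1)] ex[OF that(2)] E_sym E_trans by metis
  next
    assume "E m s t"
    then have "E m s = E m t"
      using E_sym E_trans by blast
    then show "code m s = code m t"
      by (simp add: code_def)
  qed
  define c where
    "c m t = col (en (\<psi> (res t \<beta>) q0 t)) (m, code m (res t \<beta>))" for m t
  have res_succ: "res t \<beta> = s" if "t \<in> succs s" "s \<in> L" for s t
    using that res_eq[of s t] LD by (simp add: succs_def)
  have to_q0: "\<psi> s q0 t \<in> succs q0" if "s \<in> L" "t \<in> succs s" for s t
    using psi_succs that LD q0 by metis
  have c_psi: "c m (\<psi> s s' t) = col (en (\<psi> s q0 t)) (m, code m s')"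
    if "s \<in> L" "s' \<in> L" "t \<in> succs s" for m s s' t
  proof -
    have "\<psi> s s' t \<in> succs s'"
      using psi_succs that LD by metis
    moreover have "\<psi> s' q0 (\<psi> s s' t) = \<psi> s q0 t"
      using psi_comp[of s s' q0 t] that q0 LD by (simp add: succs_def)
    ultimately show ?thesis
      using res_succ[of "\<psi> s s' t" s'] that by (simp add: c_def)
  qed
  have "good_colouring n E \<beta> c"
    unfolding good_colouring_def
  proof (intro conjI allI impI; elim conjE)
    fix m s s' t assume *: "lv s = \<beta>" "E m s s'" "t \<in> succs s"
    note L = E_L[OF *(2)]
    have "code m s = code m s'"
      using code_eq[OF L] *(2) by blast
    then show "c m (\<psi> s s' t) = c m t"
      unfolding c_psi[OF L *(3)] unfolding c_def res_succ[OF *(3) L(1)] by simp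
  next
    fix q I and v :: "nat \<times> 'a \<Rightarrow> nat"
    assume q: "q \<in> Field T" "lv q = \<beta>" and fin: "finite I"
      and sub: "I \<subseteq> {..<n} \<times> {s \<in> Field T. lv s = \<beta>}" and adm: "admissible E I"
    have qL: "q \<in> L" using q by (simp add: L_def)
    have IL: "fst p < n" "snd p \<in> L" if "p \<in> I" for p
      using that sub by (auto simp: L_def)
    define h where "h p = (fst p, code (fst p) (snd p))" for p
    have inj: "inj_on h I"
    proof (rule inj_onI)
      fix p p' assume *: "p \<in> I" "p' \<in> I" "h p = h p'"
      then have eq: "fst p = fst p'" "code (fst p) (snd p) = code (fst p) (snd p')"
        by (auto simp: h_def)
      then have "E (fst p) (snd p) (snd p')"
        using code_eq IL * by blast
      then show "p = p'"
        using adm * eq(1) unfolding admissible_def by (metis inj_onD)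
    qed
    have "inj_on fst (h ` I) \<or> (\<forall>p\<in>h ` I. \<forall>p'\<in>h ` I. fst p = fst p')"
      using adm unfolding admissible_def
    proof
      assume "inj_on fst I"
      then have "inj_on fst (h ` I)"
        by (auto simp: inj_on_def h_def)
      then show ?thesis ..
    next
      assume "\<forall>p\<in>I. \<forall>p'\<in>I. p \<noteq> p' \<longrightarrow> fst p = fst p' \<and> \<not> E (fst p) (snd p) (snd p')"
      then have "fst (h p) = fst (h p')" if "p \<in> I" "p' \<in> I" for p p'
        unfolding h_def fst_conv using that by metis
      then show ?thesis by blast
    qed
    moreover have "fst ` h ` I \<subseteq> {..<n}"
      using IL by (auto simp: h_def)
    ultimately obtain k where k: "\<forall>p\<in>h ` I. col k p = v (inv_into I h p)"
      using hit[of "h ` I" "\<lambda>p. v (inv_into I h p)"] fin by blast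
    obtain e where e: "e \<in> succs q0" "en e = k"
      using bij_betw_imp_surj_on[OF en] by (metis UNIV_I imageE)
    define z where "z = \<psi> q0 q e"
    have z: "z \<in> succs q"
      unfolding z_def using psi_succs[OF _ _ _ e(1)] LD[OF qL] LD[OF q0] by simp
    have "\<psi> q q0 z = e"
      unfolding z_def using psi_comp[of q0 q q0 e] psi_id[of q0 e] e(1) LD[OF qL] LD[OF q0]
      by (simp add: succs_def)
    then have "c (fst p) (\<psi> q (snd p) z) = col k (h p)" if "p \<in> I" for p
      using c_psi[OF qL IL(2)[OF that] z] e(2) by (simp add: h_def)
    then have "\<forall>p\<in>I. c (fst p) (\<psi> q (snd p) z) = v p"
      using k inv_into_f_f[OF inj] by simp
    then show "\<exists>z\<in>succs q. \<forall>p\<in>I. c (fst p) (\<psi> q (snd p) z) = v p"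
      using z by blast
  next
    fix s t t' assume *: "s \<in> Field T" "lv s = \<beta>" "t \<in> succs s" "t' \<in> succs s" "t \<noteq> t'"
    have sL: "s \<in> L" using * by (simp add: L_def)
    have "\<psi> s q0 t \<noteq> \<psi> s q0 t'"
      using psi_inject[of s q0 t t'] * LD[OF q0] by (simp add: succs_def)
    then have "en (\<psi> s q0 t) \<noteq> en (\<psi> s q0 t')"
      using bij_betw_imp_inj_on[OF en] to_q0[OF sL] *(3,4) by (meson inj_onD)
    then show "\<exists>m<n. c m t \<noteq> c m t'"
      using sep res_succ[OF *(3) sL] res_succ[OF *(4) sL] unfolding c_def by metis
  qed
  then show ?thesis by blast
qed

text \<open>
  Well-founded recursion on the level. The relation \<open>E\<close> is equivalence cut down to level \<open>\<beta>\<close>, so that it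
  is a function of the colours chosen before \<open>\<beta>\<close>.
\<close>

lemma good_colourings_exist:
  assumes n: "2 \<le> n"
  shows "\<exists>c. \<forall>\<beta>. good_colouring n (col_equiv c) \<beta> (c \<beta>)"
proof -
  define E where "E c \<beta> m s t \<longleftrightarrow> lv s = \<beta> \<and> col_equiv c m s t" for c \<beta> m s t
  have "\<exists>c. \<forall>\<beta>. good_colouring n (E c \<beta>) \<beta> (c \<beta>)"
  proof (rule dependent_wf_choice[OF wf])
    fix c c' :: "countable_ordinal \<Rightarrow> nat \<Rightarrow> 'a \<Rightarrow> nat" and \<beta> d
    assume "\<And>\<gamma>. (\<gamma>, \<beta>) \<in> {(x, y). x < y} \<Longrightarrow> c \<gamma> = c' \<gamma>"
    then have "E c \<beta> = E c' \<beta>"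
      by (intro ext) (auto simp: E_def col_equiv_def)
    then show "good_colouring n (E c \<beta>) \<beta> d = good_colouring n (E c' \<beta>) \<beta> d"
      by simp
  next
    fix \<beta> and c :: "countable_ordinal \<Rightarrow> nat \<Rightarrow> 'a \<Rightarrow> nat"
    show "\<exists>d. good_colouring n (E c \<beta>) \<beta> d"
      by (rule good_colouring_exists[OF n]) (auto simp: E_def col_equiv_def)
  qed
  then obtain c where c: "\<And>\<beta>. good_colouring n (E c \<beta>) \<beta> (c \<beta>)" by blast
  have "good_colouring n (col_equiv c) \<beta> (c \<beta>)" for \<beta>
  proof -
    have "admissible (E c \<beta>) I" if "admissible (col_equiv c) I" for I
      using that unfolding admissible_def E_def by blast
    then show ?thesis
      using c[of \<beta>] unfolding good_colouring_def E_def by (intro conjI) (elim conjE; blast)+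
  qed
  then show ?thesis by blast
qed

end

section \<open>Equivalence of nodes and the lifting lemma\<close>

locale coloured_tree = homogeneous_tree T lv \<psi> for T :: "'a rel" and lv \<psi> +
  fixes n :: nat and c :: "countable_ordinal \<Rightarrow> nat \<Rightarrow> 'a \<Rightarrow> nat"
  assumes good: "\<And>\<beta>. good_colouring n (col_equiv c) \<beta> (c \<beta>)"
begin

abbreviation eqv :: "nat \<Rightarrow> 'a \<Rightarrow> 'a \<Rightarrow> bool" where
  "eqv \<equiv> col_equiv c"

lemmas good_unfolded = good[unfolded good_colouring_def]

lemma colour_psi: "eqv m s s' \<Longrightarrow> t \<in> succs s \<Longrightarrow> c (lv s) m (\<psi> s s' t) = c (lv s) m t"
  using good_unfolded[of "lv s", THEN conjunct1] by simp

lemma colour_extend: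
  assumes "q \<in> Field T" "finite I" "I \<subseteq> {..<n} \<times> {s \<in> Field T. lv s = lv q}" "admissible eqv I"
  shows "\<exists>z\<in>succs q. \<forall>p\<in>I. c (lv q) (fst p) (\<psi> q (snd p) z) = v p"
  by (rule good_unfolded[of "lv q", THEN conjunct2, THEN conjunct1, rule_format])
    (intro conjI assms refl)

lemma colour_separates:
  assumes "s \<in> Field T" "t \<in> succs s" "t' \<in> succs s" "\<And>m. m < n \<Longrightarrow> c (lv s) m t = c (lv s) m t'"
  shows "t = t'"
proof (rule ccontr)
  assume "t \<noteq> t'"
  then have "\<exists>m<n. c (lv s) m t \<noteq> c (lv s) m t'"
    using assms(1-3) good_unfolded[of "lv s", THEN conjunct2, THEN conjunct2] by simp
  then show False
    using assms(4) by blast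
qed

lemma eqvD: "eqv m s t \<Longrightarrow> s \<in> Field T" "eqv m s t \<Longrightarrow> t \<in> Field T" "eqv m s t \<Longrightarrow> lv s = lv t"
  by (simp_all add: col_equiv_def)

lemma eqv_refl: "s \<in> Field T \<Longrightarrow> eqv m s s"
  by (simp add: col_equiv_def)

lemma eqv_sym: "eqv m s t \<Longrightarrow> eqv m t s"
  by (auto simp: col_equiv_def)

lemma eqv_trans: "eqv m s t \<Longrightarrow> eqv m t u \<Longrightarrow> eqv m s u"
  by (auto simp: col_equiv_def)

lemma eqv_res:
  assumes "eqv m s t" "\<beta> \<le> lv s"
  shows "eqv m (res s \<beta>) (res t \<beta>)"
proof -
  note st = eqvD[OF assms(1)]
  have \<beta>: "\<beta> \<le> lv t" using assms st by simp
  have "c \<gamma> m (res (res s \<beta>) (osuc \<gamma>)) = c \<gamma> m (res (res t \<beta>) (osuc \<gamma>))" if "\<gamma> < \<beta>" for \<gamma>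
  proof -
    have "osuc \<gamma> \<le> \<beta>" "\<gamma> < lv s" using that assms(2) by auto
    then show ?thesis
      using res_res[OF st(1) _ assms(2)] res_res[OF st(2) _ \<beta>] assms(1)
      by (simp add: col_equiv_def)
  qed
  then show ?thesis
    using res[OF st(1) assms(2)] res[OF st(2) \<beta>] by (simp add: col_equiv_def)
qed

lemma eqv_colour:
  assumes "eqv m s t" "lv s = osuc \<beta>" shows "c \<beta> m s = c \<beta> m t"
proof -
  note st = eqvD[OF assms(1)]
  have "\<beta> < lv s" using assms(2) by simp
  then have "c \<beta> m (res s (osuc \<beta>)) = c \<beta> m (res t (osuc \<beta>))"
    using assms(1) unfolding col_equiv_def by blast
  then show ?thesis
    using res_self[OF st(1)] res_self[OF st(2)] assms(2) st(3) by simp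
qed

lemma eqvI:
  assumes st: "s \<in> Field T" "t \<in> Field T" "lv s = lv t"
    and below: "\<And>\<beta>. \<beta> < lv s \<Longrightarrow> eqv m (res s \<beta>) (res t \<beta>)"
    and succ: "\<And>\<beta>. lv s = osuc \<beta> \<Longrightarrow> c \<beta> m s = c \<beta> m t"
  shows "eqv m s t"
  unfolding col_equiv_def
proof (intro conjI allI impI st)
  fix \<gamma> assume "\<gamma> < lv s"
  then have "osuc \<gamma> \<le> lv s" by simp
  then consider "osuc \<gamma> < lv s" | "lv s = osuc \<gamma>"
    by (auto simp: order_le_less)
  then show "c \<gamma> m (res s (osuc \<gamma>)) = c \<gamma> m (res t (osuc \<gamma>))"
  proof cases
    case 1
    then show ?thesis
      by (intro eqv_colour[OF below[OF 1]] res(2)[OF st(1)] less_imp_le)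
  next
    case 2
    then show ?thesis
      using succ res_self[OF st(1)] res_self[OF st(2)] st(3) by simp
  qed
qed

text \<open>
  Replacing the part of \<open>x\<close> below level \<open>lv s\<close> by an equivalent one keeps the class of \<open>x\<close>. By induction the
  predecessors of \<open>x\<close> and of its copy stay equivalent, and equivalent nodes colour their successors alike.
\<close>

lemma eqv_psi:
  assumes "eqv m s s'" "(s, x) \<in> T"
  shows "eqv m (\<psi> s s' x) x"
  using assms(2)
proof (induction "lv x" arbitrary: x rule: less_induct)
  case (less x)
  note s = eqvD[OF assms(1)]
  note x = T_Field(2)[OF less.prems]
  have lvx: "lv (\<psi> s s' x) = lv x"
    by (rule psi_lv[OF s less.prems])
  have IH: "eqv m (\<psi> s s' (res x \<beta>)) (res x \<beta>)" if "lv s \<le> \<beta>" "\<beta> < lv x" for \<beta>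
    using less.hyps[of "res x \<beta>"] res[OF x, of \<beta>] res_le[OF less.prems, of \<beta>] that by simp
  show ?case
  proof (cases "lv s = lv x")
    case True
    then have "s = x"
      using same_lv_eq[OF less.prems] by simp
    then show ?thesis
      using psi_base[OF s] eqv_sym[OF assms(1)] by simp
  next
    case False
    then have lt: "lv s < lv x"
      using lv_le[OF less.prems] by simp
    show ?thesis
    proof (rule eqvI[OF psi_Field[OF s less.prems] x lvx])
      fix \<beta> assume "\<beta> < lv (\<psi> s s' x)"
      then have \<beta>: "\<beta> < lv x" by (simp add: lvx)
      show "eqv m (res (\<psi> s s' x) \<beta>) (res x \<beta>)"
      proof (cases "lv s \<le> \<beta>")
        case True
        then show ?thesis
          using IH[OF True \<beta>] psi_res[OF s less.prems True] \<beta> by simp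
      next
        case False
        then have le: "\<beta> \<le> lv s" "\<beta> \<le> lv s'" using s by simp_all
        have "res x \<beta> = res s \<beta>" "res (\<psi> s s' x) \<beta> = res s' \<beta>"
          using res_below[OF less.prems le(1)] res_below[OF psi_above[OF s less.prems] le(2)] by auto
        then show ?thesis
          using eqv_res[OF eqv_sym[OF assms(1)] le(2)] by simp
      qed
    next
      fix \<beta> assume "lv (\<psi> s s' x) = osuc \<beta>"
      then have lvx': "lv x = osuc \<beta>" by (simp add: lvx)
      then have \<beta>: "lv s \<le> \<beta>" "\<beta> < lv x" using lt by simp_all
      define y where "y = res x \<beta>"
      have y: "(y, x) \<in> T" "lv y = \<beta>" "(s, y) \<in> T"
        unfolding y_def using res[OF x] res_le[OF less.prems \<beta>(1)] \<beta> by simp_all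
      have "c \<beta> m (\<psi> y (\<psi> s s' y) x) = c \<beta> m x"
        using colour_psi[OF eqv_sym[OF IH[OF \<beta>, folded y_def]], of x] y lvx'
        by (simp add: succs_def)
      then show "c \<beta> m (\<psi> s s' x) = c \<beta> m x"
        using psi_restrict[OF s y(3,1)] by simp
    qed
  qed
qed

text \<open>
  The independence of the colourings on single levels extends to all levels above an admissible family.
  The induction on \<open>\<alpha>\<close> also needs the copies of \<open>z\<close> above the \<open>snd p\<close> to form an admissible family again; this
  holds since equivalence is inherited by restrictions.
\<close>

lemma joint_lift:
  assumes n: "finite I" "I \<subseteq> {..<n} \<times> {s \<in> Field T. lv s = lv q}" "admissible eqv I"
    and q: "q \<in> Field T" "lv q \<le> \<alpha>"
    and t: "\<And>p. p \<in> I \<Longrightarrow> (snd p, t p) \<in> T \<and> lv (t p) = \<alpha>"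
  shows "\<exists>z. (q, z) \<in> T \<and> lv z = \<alpha> \<and> (\<forall>p\<in>I. eqv (fst p) (\<psi> q (snd p) z) (t p))"
  using q(2) t
proof (induction \<alpha> arbitrary: t rule: less_induct)
  case (less \<alpha>)
  note lq = less.prems(1)
  have I: "fst p < n" "snd p \<in> Field T" "lv q = lv (snd p)" if "p \<in> I" for p
    using n(2) that by auto
  have tp: "(snd p, t p) \<in> T" "lv (t p) = \<alpha>" "t p \<in> Field T" if "p \<in> I" for p
    using less.prems(2)[OF that] T_Field by auto
  have IH: "\<exists>z. (q, z) \<in> T \<and> lv z = \<delta> \<and> (\<forall>p\<in>I. eqv (fst p) (\<psi> q (snd p) z) (res (t p) \<delta>))"
    if \<delta>: "lv q \<le> \<delta>" "\<delta> < \<alpha>" for \<delta>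
  proof (rule less.IH[OF \<delta>(2,1)])
    fix p assume p: "p \<in> I"
    show "(snd p, res (t p) \<delta>) \<in> T \<and> lv (res (t p) \<delta>) = \<delta>"
      using res_le[OF tp(1)[OF p]] res[OF tp(3)[OF p]] I[OF p] tp(2)[OF p] \<delta> by simp
  qed
  consider (base) "lv q = \<alpha>" | (succ) \<delta> where "lv q < \<alpha>" "\<alpha> = osuc \<delta>"
    | (limit) "lv q < \<alpha>" "\<And>\<delta>. \<alpha> \<noteq> osuc \<delta>"
    using lq by (metis order_le_less)
  then show ?case
  proof cases
    case base
    have "eqv (fst p) (\<psi> q (snd p) q) (t p)" if p: "p \<in> I" for p
    proof -
      have "snd p = t p"
        using same_lv_eq[OF tp(1)[OF p]] tp(2)[OF p] I[OF p] base by simp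
      then show ?thesis
        using psi_base[OF q(1) I(2,3)[OF p]] eqv_refl tp(3)[OF p] by simp
    qed
    then show ?thesis
      using T_refl[OF q(1)] base by blast
  next
    case succ
    then have \<delta>: "lv q \<le> \<delta>" "\<delta> < \<alpha>" by simp_all
    obtain z where z: "(q, z) \<in> T" "lv z = \<delta>"
      and zt: "\<And>p. p \<in> I \<Longrightarrow> eqv (fst p) (\<psi> q (snd p) z) (res (t p) \<delta>)"
      using IH[OF \<delta>] by blast
    have zF: "z \<in> Field T" using z T_Field by blast
    define h where "h p = (fst p, \<psi> q (snd p) z)" for p :: "nat \<times> 'a"
    have lz: "lv z = lv (\<psi> q (snd p) z)" if "p \<in> I" for p
      using psi_lv[OF q(1) I(2,3)[OF that] z(1)] by simp
    have sub: "h ` I \<subseteq> {..<n} \<times> {s \<in> Field T. lv s = lv z}"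
      using I lz psi_Field[OF q(1) I(2,3) z(1)] by (auto simp: h_def)
    have r: "res (\<psi> q (snd p) z) (lv q) = snd p" if "p \<in> I" for p
      using res_eq[OF psi_above[OF q(1) I(2,3)[OF that] z(1)]] I(3)[OF that] by simp
    have inj: "p = p'" if p: "p \<in> I" "p' \<in> I" and eq: "h p = h p'" for p p'
    proof (rule prod_eqI)
      show "fst p = fst p'" using eq by (simp add: h_def)
      have "\<psi> q (snd p) z = \<psi> q (snd p') z"
        using eq by (simp add: h_def)
      then show "snd p = snd p'"
        using r[OF p(1)] r[OF p(2)] by metis
    qed
    have "admissible eqv (h ` I)"
      using n(3)[unfolded admissible_def]
    proof
      assume "inj_on fst I"
      then have "inj_on fst (h ` I)"
        by (auto simp: inj_on_def h_def)
      then show ?thesis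
        by (simp add: admissible_def)
    next
      assume *: "\<forall>p\<in>I. \<forall>p'\<in>I. p \<noteq> p' \<longrightarrow> fst p = fst p' \<and> \<not> eqv (fst p) (snd p) (snd p')"
      have "fst (h p) = fst (h p') \<and> \<not> eqv (fst (h p)) (snd (h p)) (snd (h p'))"
        if p: "p \<in> I" "p' \<in> I" "h p \<noteq> h p'" for p p'
      proof -
        have ne: "fst p = fst p'" "\<not> eqv (fst p) (snd p) (snd p')"
          using * p by auto
        have "eqv (fst p) (snd p) (snd p')" if "eqv (fst p) (\<psi> q (snd p) z) (\<psi> q (snd p') z)"
        proof -
          have "lv q \<le> lv (\<psi> q (snd p) z)"
            using lz[OF p(1)] lv_le[OF z(1)] by simp
          from eqv_res[OF that this] show ?thesis
            by (simp only: r[OF p(1)] r[OF p(2)])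
        qed
        then show ?thesis
          using ne by (auto simp: h_def)
      qed
      then show ?thesis
        unfolding admissible_def by blast
    qed
    then obtain y where y: "y \<in> succs z"
      and yt: "\<And>p. p \<in> h ` I \<Longrightarrow> c (lv z) (fst p) (\<psi> z (snd p) y) = c \<delta> (fst p) (t (inv_into I h p))"
      using colour_extend[OF zF finite_imageI[OF n(1)] sub, of "\<lambda>p. c \<delta> (fst p) (t (inv_into I h p))"]
      by blast
    have zy: "(z, y) \<in> T" "lv y = \<alpha>"
      using y z(2) succ by (auto simp: succs_def)
    have qy: "(q, y) \<in> T" using T_trans[OF z(1) zy(1)] .
    have "eqv (fst p) (\<psi> q (snd p) y) (t p)" if p: "p \<in> I" for p
    proof (rule eqvI)
      note st = q(1) I(2,3)[OF p]
      show "\<psi> q (snd p) y \<in> Field T" "t p \<in> Field T"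
        using psi_Field[OF st qy] tp(3)[OF p] by auto
      have ly: "lv (\<psi> q (snd p) y) = \<alpha>"
        using psi_lv[OF st qy] zy(2) by simp
      then show "lv (\<psi> q (snd p) y) = lv (t p)"
        using tp(2)[OF p] by simp
      have "\<psi> q (snd p) (res y \<delta>) = res (\<psi> q (snd p) y) \<delta>"
        using psi_res[OF st qy \<delta>(1)] zy(2) \<delta>(2) by simp
      moreover have "res y \<delta> = z"
        using res_eq[OF zy(1)] z(2) by simp
      ultimately have eqd: "eqv (fst p) (res (\<psi> q (snd p) y) \<delta>) (res (t p) \<delta>)"
        using zt[OF p] by simp
      show "eqv (fst p) (res (\<psi> q (snd p) y) \<beta>) (res (t p) \<beta>)" if "\<beta> < lv (\<psi> q (snd p) y)" for \<beta>
      proof -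
        have le: "\<beta> \<le> \<delta>" "\<delta> \<le> lv (\<psi> q (snd p) y)" "\<delta> \<le> lv (t p)"
          using that ly tp(2)[OF p] less_imp_le[OF \<delta>(2)] succ(2) by simp_all
        have "\<beta> \<le> lv (res (\<psi> q (snd p) y) \<delta>)"
          using res(2)[OF psi_Field[OF st qy] le(2)] le(1) by simp
        from eqv_res[OF eqd this] show ?thesis
          using res_res[OF psi_Field[OF st qy] le(1,2)] res_res[OF tp(3)[OF p] le(1,3)] by simp
      qed
      show "c \<beta> (fst p) (\<psi> q (snd p) y) = c \<beta> (fst p) (t p)" if "lv (\<psi> q (snd p) y) = osuc \<beta>" for \<beta>
      proof -
        have "\<beta> = \<delta>" using that ly succ(2) by simp
        moreover have "inv_into I h (h p) = p"
          using inj p by (intro inv_into_f_f inj_onI)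
        ultimately show ?thesis
          using yt[of "h p"] p psi_restrict[OF st z(1) zy(1)] z(2) by (simp add: h_def)
      qed
    qed
    then show ?thesis
      using qy zy(2) by blast
  next
    case limit
    show ?thesis
    proof (cases "I = {}")
      case True
      then show ?thesis
        using extend[OF q(1) lq] by blast
    next
      case False
      then obtain p0 where p0: "p0 \<in> I" by blast
      define t0 where "t0 = t p0"
      have t0: "t0 \<in> Field T" "lv t0 = \<alpha>"
        unfolding t0_def using tp[OF p0] by auto
      have "\<exists>\<delta><lv t0. lv q \<le> \<delta> \<and> (\<forall>u\<in>t ` I. \<psi> (res t0 \<delta>) (res u \<delta>) t0 = u)"
        using n(1) t0 tp limit by (intro psi_limit_finite) auto
      then obtain \<delta> where \<delta>: "lv q \<le> \<delta>" "\<delta> < \<alpha>"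
        and coh: "\<And>p. p \<in> I \<Longrightarrow> \<psi> (res t0 \<delta>) (res (t p) \<delta>) t0 = t p"
        using t0(2) by auto
      obtain z where z: "(q, z) \<in> T" "lv z = \<delta>"
        and zt: "\<And>p. p \<in> I \<Longrightarrow> eqv (fst p) (\<psi> q (snd p) z) (res (t p) \<delta>)"
        using IH[OF \<delta>] by blast
      have zF: "z \<in> Field T" using z T_Field by blast
      define r where "r = res t0 \<delta>"
      have r: "(r, t0) \<in> T" "lv r = \<delta>" "r \<in> Field T"
        unfolding r_def using res[OF t0(1)] t0(2) \<delta>(2) by auto
      have rz: "lv r = lv z" using r z by simp
      \<comment> \<open>Below \<open>\<delta>\<close> take the solution \<open>z\<close>, from \<open>\<delta>\<close> on follow \<open>t0\<close>, and with it all \<open>t p\<close>.\<close>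
      define y where "y = \<psi> r z t0"
      have zy: "(z, y) \<in> T" "lv y = \<alpha>"
        unfolding y_def using psi_above[OF r(3) zF rz r(1)] psi_lv[OF r(3) zF rz r(1)] t0(2) by auto
      have qy: "(q, y) \<in> T" using T_trans[OF z(1) zy(1)] .
      have "eqv (fst p) (\<psi> q (snd p) y) (t p)" if p: "p \<in> I" for p
      proof -
        note st = q(1) I(2,3)[OF p]
        define x where "x = \<psi> q (snd p) z"
        define u where "u = res (t p) \<delta>"
        have u: "(u, t p) \<in> T" "lv u = \<delta>" "u \<in> Field T"
          unfolding u_def using res[OF tp(3)[OF p]] tp(2)[OF p] \<delta>(2) by auto
        have x: "x \<in> Field T" "lv x = \<delta>"
          unfolding x_def using psi_Field[OF st z(1)] psi_lv[OF st z(1)] z(2) by auto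
        have "\<psi> q (snd p) y = \<psi> z x y"
          unfolding x_def using psi_restrict[OF st z(1) zy(1)] by simp
        also have "\<dots> = \<psi> r x t0"
          unfolding y_def using psi_comp[OF r(3) zF x(1) rz _ r(1)] x z by simp
        also have "\<dots> = \<psi> u x (\<psi> r u t0)"
          using psi_comp[OF r(3) u(3) x(1) _ _ r(1)] r u x by simp
        also have "\<psi> r u t0 = t p"
          unfolding r_def u_def by (rule coh[OF p])
        finally have "\<psi> q (snd p) y = \<psi> u x (t p)" .
        moreover have "eqv (fst p) u x"
          using eqv_sym[OF zt[OF p]] by (simp add: u_def x_def)
        ultimately show ?thesis
          using eqv_psi[OF _ u(1)] by simp
      qed
      then show ?thesis
        using qy zy(2) by blast
    qed
  qed
qed

end

section \<open>The factors\<close>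

context coloured_tree begin

text \<open>
  The quotient by \<open>m\<close>-equivalence is carried by representatives, so that the factors are trees on the
  node type of \<open>T\<close>. As equivalent nodes have the same level, \<open>lv\<close> serves as the level function
  of all factors.
\<close>

definition rep :: "nat \<Rightarrow> 'a \<Rightarrow> 'a" where
  "rep m s = (SOME x. eqv m s x)"

definition factor :: "nat \<Rightarrow> 'a rel" where
  "factor m = {(rep m s, rep m t) | s t. (s, t) \<in> T}"

lemma rep_eqv: "s \<in> Field T \<Longrightarrow> eqv m s (rep m s)"
  unfolding rep_def by (rule someI[of "eqv m s" s]) (rule eqv_refl)

lemma rep_eq_iff:
  assumes "s \<in> Field T" "t \<in> Field T" shows "rep m s = rep m t \<longleftrightarrow> eqv m s t"
proof
  assume eq: "rep m s = rep m t"
  show "eqv m s t"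
    using eqv_trans[OF rep_eqv[OF assms(1), of m, unfolded eq] eqv_sym[OF rep_eqv[OF assms(2)]]] .
next
  assume "eqv m s t"
  then have "eqv m s = eqv m t"
    using eqv_sym eqv_trans by blast
  then show "rep m s = rep m t"
    by (simp add: rep_def)
qed

lemma rep_Field: "s \<in> Field T \<Longrightarrow> rep m s \<in> Field T"
  using rep_eqv eqvD by blast

lemma lv_rep: "s \<in> Field T \<Longrightarrow> lv (rep m s) = lv s"
  using eqvD(3)[OF rep_eqv] by simp

lemma rep_rep: "s \<in> Field T \<Longrightarrow> rep m (rep m s) = rep m s"
  using rep_eq_iff[OF _ rep_Field] rep_eqv by metis

lemma factor_mono: "(s, t) \<in> T \<Longrightarrow> (rep m s, rep m t) \<in> factor m"
  by (auto simp: factor_def)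

lemma Field_factor: "Field (factor m) = rep m ` Field T"
proof (intro equalityI subsetI)
  fix x assume "x \<in> rep m ` Field T"
  then show "x \<in> Field (factor m)"
    using factor_mono[OF T_refl, of _ m] by (auto simp: Field_def)
qed (auto simp: factor_def Field_def)

lemma factor_nodeD: "x \<in> Field (factor m) \<Longrightarrow> x \<in> Field T" "x \<in> Field (factor m) \<Longrightarrow> rep m x = x"
  using rep_Field rep_rep by (auto simp: Field_factor)

text \<open>
  Equivalence is inherited by restrictions, so the order of the quotient does not depend on representatives.
\<close>

lemma factor_iff:
  assumes st: "s \<in> Field T" "t \<in> Field T"
  shows "(rep m s, rep m t) \<in> factor m \<longleftrightarrow> lv s \<le> lv t \<and> eqv m s (res t (lv s))"
proof
  assume "(rep m s, rep m t) \<in> factor m"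
  then obtain s' t' where *: "(s', t') \<in> T" "rep m s = rep m s'" "rep m t = rep m t'"
    by (auto simp: factor_def)
  then have e: "eqv m s s'" "eqv m t t'"
    using rep_eq_iff st T_Field by blast+
  have le: "lv s \<le> lv t"
    using eqvD(3)[OF e(1)] eqvD(3)[OF e(2)] lv_le[OF *(1)] by simp
  moreover have "res t' (lv s) = s'"
    using res_eq[OF *(1)] eqvD(3)[OF e(1)] by simp
  ultimately show "lv s \<le> lv t \<and> eqv m s (res t (lv s))"
    using eqv_res[OF e(2) le] eqv_trans[OF e(1) eqv_sym] by simp
next
  assume *: "lv s \<le> lv t \<and> eqv m s (res t (lv s))"
  note r = res[OF st(2) conjunct1[OF *]]
  have "rep m s = rep m (res t (lv s))"
    using rep_eq_iff[OF st(1) r(3)] * by simp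
  then show "(rep m s, rep m t) \<in> factor m"
    using factor_mono[OF r(1)] by simp
qed

lemma factor_iff':
  assumes "x \<in> Field (factor m)" "y \<in> Field (factor m)"
  shows "(x, y) \<in> factor m \<longleftrightarrow> lv x \<le> lv y \<and> eqv m x (res y (lv x))"
  using factor_iff[OF factor_nodeD(1)[OF assms(1)] factor_nodeD(1)[OF assms(2)], of m]
    factor_nodeD(2)[OF assms(1)] factor_nodeD(2)[OF assms(2)] by simp

lemma factor_node_eqv: "x \<in> Field (factor m) \<Longrightarrow> y \<in> Field (factor m) \<Longrightarrow> eqv m x y \<Longrightarrow> x = y"
  using rep_eq_iff[of x y m] factor_nodeD[of x m] factor_nodeD[of y m] by simp

lemma factor_Field: "(x, y) \<in> factor m \<Longrightarrow> x \<in> Field (factor m)" "(x, y) \<in> factor m \<Longrightarrow> y \<in> Field (factor m)"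
  by (auto simp: Field_def)

lemma factorD:
  assumes "(x, y) \<in> factor m" shows "lv x \<le> lv y" "eqv m x (res y (lv x))"
  using factor_iff'[OF factor_Field[OF assms]] assms by simp_all

lemma level_tree_factor: "level_tree (factor m) lv"
proof
  have refl: "(x, x) \<in> factor m" if "x \<in> Field (factor m)" for x
    using factor_mono[OF T_refl] that by (auto simp: Field_factor)
  have trans: "(x, z) \<in> factor m" if xy: "(x, y) \<in> factor m" and yz: "(y, z) \<in> factor m" for x y z
  proof -
    note F = factor_Field[OF xy] factor_Field(2)[OF yz]
    note xy' = factorD[OF xy] and yz' = factorD[OF yz]
    have "eqv m (res y (lv x)) (res (res z (lv y)) (lv x))"
      by (rule eqv_res[OF yz'(2) xy'(1)])
    then have "eqv m x (res z (lv x))"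
      using eqv_trans[OF xy'(2)] res_res[OF factor_nodeD(1)[OF F(3)] xy'(1) yz'(1)] by simp
    then show ?thesis
      using factor_iff'[OF F(1,3)] xy'(1) yz'(1) by simp
  qed
  have eq: "x = y" if xy: "(x, y) \<in> factor m" and lv: "lv x = lv y" for x y
    using factorD(2)[OF xy] factor_node_eqv factor_Field[OF xy] lv res_self factor_nodeD(1) by metis
  show "Partial_order (factor m)"
    unfolding order_on_defs
  proof (intro conjI)
    show "refl_on (Field (factor m)) (factor m)"
      using refl by (intro refl_onI)
    show "trans (factor m)"
      using trans by (intro transI)
    show "antisym (factor m)"
      using eq factorD(1) by (intro antisymI) (metis order_antisym)
    show "factor m \<subseteq> Field (factor m) \<times> Field (factor m)"
      by (auto intro: FieldI1 FieldI2)
  qed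
  show "lv x < lv y" if "(x, y) \<in> factor m" "x \<noteq> y" for x y
    using eq[OF that(1)] that(2) factorD(1)[OF that(1)] by fastforce
  show "\<exists>x. (x, y) \<in> factor m \<and> lv x = \<beta>" if y: "y \<in> Field (factor m)" and \<beta>: "\<beta> \<le> lv y" for y \<beta>
  proof -
    note r = res[OF factor_nodeD(1)[OF y] \<beta>]
    have "(rep m (res y \<beta>), y) \<in> factor m"
      using factor_mono[OF r(1), of m] factor_nodeD(2)[OF y] by simp
    then show ?thesis
      using lv_rep[OF r(3)] r(2) by (intro exI[of _ "rep m (res y \<beta>)"]) simp
  qed
  show "x = x'" if *: "(x, y) \<in> factor m" "(x', y) \<in> factor m" "lv x = lv x'" for x x' y
    by (rule factor_node_eqv[OF factor_Field(1)[OF *(1)] factor_Field(1)[OF *(2)]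
          eqv_trans[OF factorD(2)[OF *(1)] eqv_sym[OF factorD(2)[OF *(2), folded *(3)]]]])
qed

text \<open>
  Infinite splitting holds because each colour occurs among the successors of a node, which is
  independence for a single node. The c.c.c. is inherited since representatives that are comparable in \<open>T\<close>
  are comparable in the factor.
\<close>

lemma omega1_tree_factor:
  assumes m: "m < n" shows "omega1_tree (factor m) lv"
proof -
  interpret F: level_tree "factor m" lv by (rule level_tree_factor)
  have F_res: "F.res x \<beta> = rep m (res x \<beta>)" if x: "x \<in> Field (factor m)" and \<beta>: "\<beta> \<le> lv x" for x \<beta>
  proof -
    note r = res[OF factor_nodeD(1)[OF x] \<beta>]
    have "(rep m (res x \<beta>), x) \<in> factor m"
      using factor_mono[OF r(1), of m] factor_nodeD(2)[OF x] by simp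
    from F.res_eq[OF this] show ?thesis
      using lv_rep[OF r(3)] r(2) by simp
  qed
  show ?thesis
  proof
    show "Field (factor m) \<noteq> {}"
      using nonempty by (simp add: Field_factor)
  next
    fix x \<beta> assume x: "x \<in> Field (factor m)" "lv x \<le> \<beta>"
    obtain t where t: "(x, t) \<in> T" "lv t = \<beta>"
      using extend[OF factor_nodeD(1)[OF x(1)] x(2)] by blast
    then have "(x, rep m t) \<in> factor m"
      using factor_mono[OF t(1), of m] factor_nodeD(2)[OF x(1)] by simp
    then show "\<exists>y. (x, y) \<in> factor m \<and> lv y = \<beta>"
      using lv_rep[OF T_Field(2)[OF t(1)]] t(2) by (intro exI[of _ "rep m t"]) simp
  next
    fix x y assume xy: "x \<in> Field (factor m)" "y \<in> Field (factor m)" "lv x = lv y"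
      and lim: "\<And>\<beta>. lv x \<noteq> osuc \<beta>"
      and below: "\<And>\<beta>. \<beta> < lv x \<Longrightarrow> F.res x \<beta> = F.res y \<beta>"
    have F: "x \<in> Field T" "y \<in> Field T"
      using xy factor_nodeD by auto
    have "eqv m x y"
    proof (rule eqvI[OF F xy(3)])
      fix \<beta> assume \<beta>: "\<beta> < lv x"
      then have le: "\<beta> \<le> lv x" "\<beta> \<le> lv y" using xy(3) by simp_all
      have "rep m (res x \<beta>) = rep m (res y \<beta>)"
        using below[OF \<beta>] F_res[OF xy(1) le(1)] F_res[OF xy(2) le(2)] by simp
      then show "eqv m (res x \<beta>) (res y \<beta>)"
        using rep_eq_iff[OF res(3)[OF F(1) le(1)] res(3)[OF F(2) le(2)]] by simp
    qed (use lim in simp)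
    then show "x = y"
      by (rule factor_node_eqv[OF xy(1,2)])
  next
    fix x assume x: "x \<in> Field (factor m)"
    note xT = factor_nodeD(1)[OF x]
    have "rep m t \<in> F.succs x \<and> c (lv x) m (rep m t) = c (lv x) m t" if t: "t \<in> succs x" for t
    proof -
      have t': "(x, t) \<in> T" "lv t = osuc (lv x)" "t \<in> Field T"
        using t T_Field by (auto simp: succs_def)
      show ?thesis
        using factor_mono[OF t'(1), of m] factor_nodeD(2)[OF x] lv_rep[OF t'(3)] t'(2)
          eqv_colour[OF rep_eqv[OF t'(3)] t'(2)]
        by (simp add: F.succs_def)
    qed
    moreover have "\<exists>t\<in>succs x. c (lv x) m t = k" for k
    proof -
      have "\<exists>z\<in>succs x. \<forall>p\<in>{(m, x)}. c (lv x) (fst p) (\<psi> x (snd p) z) = k"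
        using m xT by (intro colour_extend) (auto simp: admissible_def)
      then show ?thesis
        using psi_id by (auto simp: succs_def)
    qed
    ultimately have "\<exists>y\<in>F.succs x. c (lv x) m y = k" for k
      by metis
    then have "c (lv x) m ` F.succs x = UNIV"
      by (auto simp: image_iff) metis
    then show "infinite (F.succs x)"
      by (metis finite_imageI infinite_UNIV_nat)
  next
    show "ccc (factor m)"
      unfolding ccc_def
    proof (intro allI impI)
      fix A assume A: "antichain (factor m) A"
      then have sub: "A \<subseteq> Field (factor m)"
        by (simp add: antichain_def)
      have "(s, t) \<in> factor m" if "(s, t) \<in> T" "s \<in> A" "t \<in> A" for s t
        using factor_mono[OF that(1), of m] factor_nodeD(2) sub that by (metis subsetD)
      then have "antichain T A"
        using A factor_nodeD(1) unfolding antichain_def by blast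
      then show "countable A"
        using ccc by (simp add: ccc_def)
    qed
  qed
qed

end

section \<open>The factors are free\<close>

context coloured_tree begin

text \<open>
  A tuple \<open>a\<close> in the product is lifted to a node \<open>z a\<close> above \<open>q\<close> whose copy above each \<open>s \<in> F\<close> represents
  \<open>a s\<close>. If \<open>z a\<close> is below \<open>z b\<close>, then so are all the copies, hence \<open>a\<close> is below \<open>b\<close>. Thus \<open>z\<close> maps
  antichains injectively to antichains of \<open>T\<close>.
\<close>

lemma ccc_factor_product:
  assumes m: "m < n" and F: "finite F" "F \<noteq> {}" "F \<subseteq> Field (factor m)"
    and level: "\<And>s t. s \<in> F \<Longrightarrow> t \<in> F \<Longrightarrow> lv s = lv t"
  shows "ccc (tree_product F (subtree (factor m)))"
proof -
  interpret F: omega1_tree "factor m" lv by (rule omega1_tree_factor[OF m])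
  let ?P = "tree_product F (subtree (factor m))"
  define N where "N = (\<Union>\<alpha> :: 'a rel. \<Pi>\<^sub>E s\<in>F. level (subtree (factor m) s) \<alpha>)"
  have P: "(a, b) \<in> ?P \<longleftrightarrow> a \<in> N \<and> b \<in> N \<and> (\<forall>s\<in>F. (a s, b s) \<in> subtree (factor m) s)" for a b
    by (auto simp: tree_product_def N_def)
  obtain q where qF: "q \<in> F" using F(2) by blast
  have FT: "s \<in> Field T" "rep m s = s" "lv q = lv s" if "s \<in> F" for s
    using factor_nodeD F(3) that level[OF qF] by auto
  note q = FT(1)[OF qF]
  have node: "a \<in> extensional F" "\<And>s. s \<in> F \<Longrightarrow> (s, a s) \<in> factor m"
    "\<And>s t. s \<in> F \<Longrightarrow> t \<in> F \<Longrightarrow> lv (a s) = lv (a t)" if aN: "a \<in> N" for a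
  proof -
    obtain \<alpha> :: "'a rel" where a: "a \<in> (\<Pi>\<^sub>E s\<in>F. level (subtree (factor m) s) \<alpha>)"
      using aN unfolding N_def by blast
    then show "a \<in> extensional F" by (simp add: PiE_iff)
    have as: "a s \<in> level (subtree (factor m) s) \<alpha>" if "s \<in> F" for s
      using a that by (simp add: PiE_iff)
    have "s \<in> Field (factor m)" if "s \<in> F" for s
      using F(3) that by blast
    then have *: "(s, a s) \<in> factor m \<and> lv (a s) = lv (a t)" if "s \<in> F" "t \<in> F" for s t
      using F.subtree_levels[OF _ _ level[OF that] as[OF that(1)] as[OF that(2)]] that by blast
    show "(s, a s) \<in> factor m" if "s \<in> F" for s
      using *[OF that that] by blast
    show "lv (a s) = lv (a t)" if "s \<in> F" "t \<in> F" for s t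
      using *[OF that] by blast
  qed
  have lift: "\<exists>z. (q, z) \<in> T \<and> (\<forall>s\<in>F. eqv m (\<psi> q s z) (a s))" if a: "a \<in> N" for a
  proof -
    note node = node[OF a]
    have aF: "a s \<in> Field T" "lv s \<le> lv (a s)" "eqv m s (res (a s) (lv s))" if "s \<in> F" for s
      using factor_nodeD(1)[OF factor_Field(2)[OF node(2)[OF that]]] factorD[OF node(2)[OF that]]
      by auto
    \<comment> \<open>The nodes \<open>a s\<close> are above \<open>s\<close> in the factor only; \<open>t s\<close> is an equivalent node above \<open>s\<close> in \<open>T\<close>.\<close>
    define t where "t s = \<psi> (res (a s) (lv s)) s (a s)" for s
    have t: "(s, t s) \<in> T" "lv (t s) = lv (a s)" "eqv m (t s) (a s)" if s: "s \<in> F" for s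
    proof -
      note r = res[OF aF(1,2)[OF s]]
      show "(s, t s) \<in> T" "lv (t s) = lv (a s)"
        unfolding t_def using psi_above[OF r(3) FT(1)[OF s] r(2) r(1)] psi_lv[OF r(3) FT(1)[OF s] r(2) r(1)]
        by auto
      show "eqv m (t s) (a s)"
        unfolding t_def by (rule eqv_psi[OF eqv_sym[OF aF(3)[OF s]] r(1)])
    qed
    have "\<exists>z. (q, z) \<in> T \<and> lv z = lv (a q) \<and>
        (\<forall>p\<in>{m} \<times> F. eqv (fst p) (\<psi> q (snd p) z) (t (snd p)))"
    proof (rule joint_lift[OF _ _ _ q])
      show "finite ({m} \<times> F)" using F(1) by simp
      show "{m} \<times> F \<subseteq> {..<n} \<times> {s \<in> Field T. lv s = lv q}"
        using m FT by auto
      show "admissible eqv ({m} \<times> F)"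
        unfolding admissible_def
        using factor_node_eqv F(3) by (intro disjI2) (auto dest: subsetD)
      show "lv q \<le> lv (a q)" using aF(2)[OF qF] .
      show "(snd p, t (snd p)) \<in> T \<and> lv (t (snd p)) = lv (a q)" if "p \<in> {m} \<times> F" for p
        using t(1,2)[of "snd p"] node(3)[OF _ qF, of "snd p"] that by auto
    qed
    then obtain z where z: "(q, z) \<in> T" "\<And>s. s \<in> F \<Longrightarrow> eqv m (\<psi> q s z) (t s)"
      by auto
    then show ?thesis
      using eqv_trans t(3) by blast
  qed
  then obtain z where z: "\<And>a. a \<in> N \<Longrightarrow> (q, z a) \<in> T"
      and za: "\<And>a s. a \<in> N \<Longrightarrow> s \<in> F \<Longrightarrow> eqv m (\<psi> q s (z a)) (a s)"
    by metis
  have mono: "(a, b) \<in> ?P" if ab: "a \<in> N" "b \<in> N" and le: "(z a, z b) \<in> T" for a b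
    unfolding P
  proof (intro conjI ballI ab)
    fix s assume s: "s \<in> F"
    note st = q FT(1,3)[OF s]
    have "(\<psi> q s (z a), \<psi> q s (z b)) \<in> T"
      using psi_le_iff[OF st z[OF ab(1)] z[OF ab(2)]] le by simp
    from factor_mono[OF this]
    have "(rep m (\<psi> q s (z a)), rep m (\<psi> q s (z b))) \<in> factor m" .
    moreover have "rep m (\<psi> q s (z a)) = a s" if "a \<in> N" for a
    proof -
      have "a s \<in> Field (factor m)"
        using node(2)[OF that s] factor_Field by blast
      from factor_nodeD(2)[OF this] show ?thesis
        using rep_eq_iff[OF eqvD(1,2)[OF za[OF that s]], of m] za[OF that s] by simp
    qed
    ultimately have "(a s, b s) \<in> factor m"
      using ab by simp
    then show "(a s, b s) \<in> subtree (factor m) s"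
      using node(2)[OF ab(1) s] node(2)[OF ab(2) s] by (simp add: subtree_def above_def)
  qed
  show ?thesis
    unfolding ccc_def
  proof (intro allI impI)
    fix A assume A: "antichain ?P A"
    have AN: "A \<subseteq> N"
      using A P by (auto simp: antichain_def Field_def)
    have eq: "a = b" if "a \<in> A" "b \<in> A" "(z a, z b) \<in> T" for a b
      using mono[of a b] that AN A unfolding antichain_def by blast
    have "inj_on z A"
    proof (rule inj_onI)
      fix a b assume ab: "a \<in> A" "b \<in> A" "z a = z b"
      have "(z a, z b) \<in> T"
        using z[of a] T_refl T_Field ab AN by auto
      then show "a = b" using eq ab by blast
    qed
    moreover have "antichain T (z ` A)"
      unfolding antichain_def using z AN eq T_Field by blast
    then have "countable (z ` A)"
      using ccc by (simp add: ccc_def)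
    ultimately show "countable A"
      using countable_image_inj_on by blast
  qed
qed

lemma free_tree_factor:
  assumes m: "m < n" shows "free_tree (factor m)"
proof -
  interpret F: omega1_tree "factor m" lv by (rule omega1_tree_factor[OF m])
  show ?thesis
    unfolding free_tree_def
  proof (intro conjI allI impI; (elim conjE)?)
    show "normal_tree omega1 (factor m)" by (rule F.normal_tree)
  next
    fix F assume F: "finite F" "F \<noteq> {}" "F \<subseteq> Field (factor m)"
      and ht: "\<forall>s\<in>F. \<forall>t\<in>F. ht (factor m) s =o ht (factor m) t"
    show "ccc (tree_product F (subtree (factor m)))"
    proof (rule ccc_factor_product[OF m F])
      fix s t assume "s \<in> F" "t \<in> F"
      then show "lv s = lv t"
        using ht F.same_height_iff[of s t] F(3) by blast
    qed
  qed
qed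

end

section \<open>The tree is the product of its factors\<close>

context coloured_tree begin

text \<open>
  By induction on the level the restrictions of the two nodes agree; at a successor level the
  colours separate, and at a limit level nodes are determined by their predecessors.
\<close>

lemma eq_if_all_eqv:
  assumes "s \<in> Field T" "t \<in> Field T" "lv s = lv t" "\<And>m. m < n \<Longrightarrow> eqv m s t"
  shows "s = t"
  using assms
proof (induction "lv s" arbitrary: s t rule: less_induct)
  case (less s t)
  note st = less.prems(1-3)
  have below: "res s \<beta> = res t \<beta>" if \<beta>: "\<beta> < lv s" for \<beta>
  proof -
    have le: "\<beta> \<le> lv s" "\<beta> \<le> lv t" using \<beta> st(3) by simp_all
    note r = res[OF st(1) le(1)] and r' = res[OF st(2) le(2)]
    show ?thesis
    proof (rule less.hyps[OF _ r(3) r'(3)])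
      show "lv (res s \<beta>) < lv s" "lv (res s \<beta>) = lv (res t \<beta>)"
        using r r' \<beta> by simp_all
      show "eqv m (res s \<beta>) (res t \<beta>)" if "m < n" for m
        by (rule eqv_res[OF less.prems(4)[OF that] le(1)])
    qed
  qed
  show ?case
  proof (cases "\<exists>\<beta>. lv s = osuc \<beta>")
    case True
    then obtain \<beta> where \<beta>: "lv s = osuc \<beta>" by blast
    then have le: "\<beta> \<le> lv s" "\<beta> \<le> lv t" "\<beta> < lv s" using st(3) by (simp_all add: less_imp_le)
    define r where "r = res s \<beta>"
    have r: "(r, s) \<in> T" "(r, t) \<in> T" "lv r = \<beta>" "r \<in> Field T"
      using res[OF st(1) le(1)] res[OF st(2) le(2)] below[OF le(3)] by (simp_all add: r_def)
    show ?thesis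
    proof (rule colour_separates[OF r(4)])
      show "s \<in> succs r" "t \<in> succs r"
        using r \<beta> st(3) by (simp_all add: succs_def)
      show "c (lv r) m s = c (lv r) m t" if "m < n" for m
        unfolding r(3) by (rule eqv_colour[OF less.prems(4)[OF that] \<beta>])
    qed
  next
    case False
    then show ?thesis
      by (intro limit_unique[OF st]) (auto intro: below)
  qed
qed

text \<open>
  Mapping a node to the tuple of its representatives is injective and reflects the order by
  \<open>eq_if_all_eqv\<close>; surjectivity is the lifting lemma above the root with one node per index.
\<close>

lemma tree_isomorphic_product:
  assumes n: "0 < n"
  shows "tree_isomorphic T (tree_product {..<n} factor)"
proof -
  define h where "h t = (\<lambda>m\<in>{..<n}. rep m t)" for t
  define N where "N = {f \<in> (\<Pi>\<^sub>E m\<in>{..<n}. Field (factor m)). \<forall>i\<in>{..<n}. \<forall>j\<in>{..<n}. lv (f i) = lv (f j)}"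
  have "(\<Union>\<alpha> :: 'a rel. \<Pi>\<^sub>E m\<in>{..<n}. level (factor m) \<alpha>) = N"
    unfolding N_def by (rule tree_product_nodes) (use n level_tree_factor in auto)
  then have "tree_product {..<n} factor = {(f, g) \<in> N \<times> N. \<forall>m\<in>{..<n}. (f m, g m) \<in> factor m}"
    unfolding tree_product_def by simp
  then have P: "(f, g) \<in> tree_product {..<n} factor \<longleftrightarrow> f \<in> N \<and> g \<in> N \<and> (\<forall>m<n. (f m, g m) \<in> factor m)"
    for f g by auto
  have hN: "h t \<in> N" if "t \<in> Field T" for t
    using that lv_rep by (auto simp: h_def N_def Field_factor)
  have N_refl: "(f, f) \<in> tree_product {..<n} factor" if "f \<in> N" for f
  proof -
    have "f m \<in> Field (factor m)" if "m < n" for m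
      using \<open>f \<in> N\<close> that unfolding N_def PiE_iff by blast
    then show ?thesis
      unfolding P using that level_tree.T_refl[OF level_tree_factor] by blast
  qed
  have "Field (tree_product {..<n} factor) = N"
  proof (intro equalityI subsetI)
    fix f assume "f \<in> N"
    from FieldI1[OF N_refl[OF this]] show "f \<in> Field (tree_product {..<n} factor)" .
  next
    fix f assume "f \<in> Field (tree_product {..<n} factor)"
    then obtain g where "(f, g) \<in> tree_product {..<n} factor \<or> (g, f) \<in> tree_product {..<n} factor"
      by (auto simp: Field_def)
    then show "f \<in> N"
      unfolding P by blast
  qed
  moreover have iff: "(h s, h t) \<in> tree_product {..<n} factor \<longleftrightarrow> (s, t) \<in> T"
    if st: "s \<in> Field T" "t \<in> Field T" for s t
  proof
    assume "(s, t) \<in> T"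
    then show "(h s, h t) \<in> tree_product {..<n} factor"
      unfolding P using hN st factor_mono by (simp add: h_def)
  next
    assume "(h s, h t) \<in> tree_product {..<n} factor"
    then have *: "lv s \<le> lv t" "eqv m s (res t (lv s))" if "m < n" for m
      using that factor_iff[OF st] unfolding P by (auto simp: h_def)
    note r = res[OF st(2) *(1)[OF n]]
    have "s = res t (lv s)"
      by (rule eq_if_all_eqv[OF st(1) r(3) r(2)[symmetric]]) (rule *(2))
    then show "(s, t) \<in> T"
      using r(1) by simp
  qed
  moreover have "inj_on h (Field T)"
  proof (rule inj_onI)
    fix s t assume st: "s \<in> Field T" "t \<in> Field T" and eq: "h s = h t"
    have "(s, t) \<in> T" "(t, s) \<in> T"
      using iff[OF st] iff[OF st(2,1)] eq N_refl[OF hN[OF st(1)]] by simp_all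
    then show "s = t" by (rule T_antisym)
  qed
  moreover have "h ` Field T = N"
  proof (intro equalityI subsetI)
    fix f assume "f \<in> N"
    then have f: "f \<in> extensional {..<n}" "\<And>m. m < n \<Longrightarrow> f m \<in> Field (factor m)"
      and lv: "\<And>m. m < n \<Longrightarrow> lv (f m) = lv (f 0)"
      using n unfolding N_def PiE_iff by blast+
    have "\<exists>z. (root, z) \<in> T \<and> lv z = lv (f 0) \<and>
        (\<forall>p\<in>{..<n} \<times> {root}. eqv (fst p) (\<psi> root (snd p) z) (f (fst p)))"
    proof (rule joint_lift[OF _ _ _ root_Field lv_root])
      show "admissible eqv ({..<n} \<times> {root})"
        by (auto simp: admissible_def inj_on_def)
      show "(snd p, f (fst p)) \<in> T \<and> lv (f (fst p)) = lv (f 0)" if "p \<in> {..<n} \<times> {root}" for p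
        using that root_least[OF factor_nodeD(1)[OF f(2)], of "fst p"] lv[of "fst p"] by auto
    qed (use root_Field in auto)
    then obtain z where z: "(root, z) \<in> T" "\<And>m. m < n \<Longrightarrow> eqv m (\<psi> root root z) (f m)"
      by auto
    have "rep m z = f m" if "m < n" for m
      using rep_eq_iff[of z "f m" m] z(2)[OF that] psi_id[OF z(1)] T_Field(2)[OF z(1)]
        factor_nodeD[OF f(2)[OF that]] by simp
    then have "h z = f"
      using f(1) by (auto simp: h_def fun_eq_iff extensional_def)
    then show "f \<in> h ` Field T"
      using T_Field(2)[OF z(1)] by blast
  qed (use hN in auto)
  ultimately have "tree_iso h T (tree_product {..<n} factor)"
    by (simp add: tree_iso_def bij_betw_def)
  then show ?thesis
    unfolding tree_isomorphic_def by blast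
qed

end

theorem theorem2p4:
  fixes n :: nat and T :: "'a rel"
  assumes "n > 1"
    and "Souslin_tree T" and "aleph0_splitting T" and "strongly_homogeneous T"
  shows "\<exists>S :: nat \<Rightarrow> 'a rel.
           (\<forall>m<n. Souslin_tree (S m) \<and> free_tree (S m)) \<and>
           tree_isomorphic T (tree_product {..<n} S)"
proof -
  obtain \<psi> where \<psi>: "coherent_family T \<psi>"
    using assms(4) by (auto simp: strongly_homogeneous_def)
  obtain lv where "omega1_tree T lv"
    using Souslin_tree_imp_omega1_tree[OF assms(2)] .
  then interpret homogeneous_tree T lv \<psi>
    by (rule omega1_tree.homogeneous_tree_coherent[OF _ \<psi>])
  have "2 \<le> n" using assms(1) by simp
  then obtain c where c: "\<And>\<beta>. good_colouring n (col_equiv c) \<beta> (c \<beta>)"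
    using good_colourings_exist by blast
  interpret coloured_tree T lv \<psi> n c
    by standard (rule c)
  have "Souslin_tree (factor m) \<and> free_tree (factor m)" if "m < n" for m
    using omega1_tree.Souslin_tree[OF omega1_tree_factor[OF that]] free_tree_factor[OF that] by blast
  moreover have "tree_isomorphic T (tree_product {..<n} factor)"
    using tree_isomorphic_product assms(1) by simp
  ultimately show ?thesis by blast
qed

end
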